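(* For every infinite sequence of primes $\Pi=(p_1,p_2,\ldots)$ (not necessarily distinct), there exists a finitely generated infinite torsion $\Pi$-graded group $Q$ with positive rank gradient, i.e. with $\mathrm{RG}(Q)>0$.
   Context: For a finitely generated group $G$, let $d(G)$ denote the minimal number of generators of $G$. The rank gradient of a finitely generated group $G$ is $$\mathrm{RG}(G)=\inf_{[G:H]<\infty}\frac{d(H)-1}{[G:H]},$$ where the infimum is taken over all finite index subgroups $H\le G$. Given a sequence of primes $\Pi=(p_i)_{i\ge 1}$, a $\Pi$-series in a group $G$ is a chain of normal subgroups $G=G_0\rhd G_1\rhd\cdots$ of $G$ such that for each $i\ge 1$ the quotient $G_{i-1}/G_i$ is either trivial or abelian of exponent $p_i$. (Successive terms may coincide.) A group $G$ is $\Pi$-graded if it admits a $\Pi$-series $\{G_i\}$ with $\bigcap_i G_i=\{1\}$. A group is torsion if each of its elements has finite order. *)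

theory Defs
  imports
    Complex_Main
    "HOL-Algebra.Elementary_Groups"
    "HOL-Computational_Algebra.Primes"
begin

definition generates :: "('a, 'b) monoid_scheme \<Rightarrow> 'a set \<Rightarrow> bool" where
  "generates G S \<longleftrightarrow> S \<subseteq> carrier G \<and> generate G S = carrier G"

definition finitely_generated :: "('a, 'b) monoid_scheme \<Rightarrow> bool" where
  "finitely_generated G \<longleftrightarrow> (\<exists>S. finite S \<and> generates G S)"

text \<open>The minimal number of generators \<open>d(G)\<close>. It is meaningful only for finitely generated
  groups; otherwise the value is unspecified.\<close>

definition min_generators :: "('a, 'b) monoid_scheme \<Rightarrow> nat" where
  "min_generators G = (LEAST n. \<exists>S. finite S \<and> card S = n \<and> generates G S)"

definition finite_index_subgroup :: "'a set \<Rightarrow> ('a, 'b) monoid_scheme \<Rightarrow> bool" where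
  "finite_index_subgroup H G \<longleftrightarrow> subgroup H G \<and> finite (rcosets\<^bsub>G\<^esub> H)"

definition subgroup_index :: "('a, 'b) monoid_scheme \<Rightarrow> 'a set \<Rightarrow> nat" where
  "subgroup_index G H = card (rcosets\<^bsub>G\<^esub> H)"

text \<open>If \<open>G\<close> is finitely generated, then so is every \<open>H\<close> occurring below. The infimum is taken
  in the reals, over a set that contains the value for \<open>H = G\<close> and is bounded below by \<open>-1\<close>
  (negative values occur exactly for trivial \<open>H\<close>).\<close>

definition rank_gradient :: "('a, 'b) monoid_scheme \<Rightarrow> real" where
  "rank_gradient G =
    (INF H \<in> {H. finite_index_subgroup H G}.
      (real (min_generators (G\<lparr>carrier := H\<rparr>)) - 1) / real (subgroup_index G H))"

text \<open>The exponent is the least positive \<open>n\<close> that annihilates the group.\<close>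

definition has_exponent :: "('a, 'b) monoid_scheme \<Rightarrow> nat \<Rightarrow> bool" where
  "has_exponent G n \<longleftrightarrow>
    0 < n \<and> (\<forall>x\<in>carrier G. x [^]\<^bsub>G\<^esub> n = \<one>\<^bsub>G\<^esub>) \<and>
    (\<forall>m. 0 < m \<and> m < n \<longrightarrow> (\<exists>x\<in>carrier G. x [^]\<^bsub>G\<^esub> m \<noteq> \<one>\<^bsub>G\<^esub>))"

text \<open>The sequence of primes is \<open>p 1, p 2, \<dots>\<close>; the value \<open>p 0\<close> plays no role.\<close>

definition graded_series ::
    "(nat \<Rightarrow> nat) \<Rightarrow> ('a, 'b) monoid_scheme \<Rightarrow> (nat \<Rightarrow> 'a set) \<Rightarrow> bool" where
  "graded_series p G N \<longleftrightarrow>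
    N 0 = carrier G \<and>
    (\<forall>i. N i \<lhd> G) \<and>
    (\<forall>i\<ge>1. N i \<subseteq> N (i - 1)) \<and>
    (\<forall>i\<ge>1. let F = (G\<lparr>carrier := N (i - 1)\<rparr>) Mod N i in
       trivial_group F \<or> (comm_group F \<and> has_exponent F (p i)))"

definition graded_group :: "(nat \<Rightarrow> nat) \<Rightarrow> ('a, 'b) monoid_scheme \<Rightarrow> bool" where
  "graded_group p G \<longleftrightarrow> (\<exists>N. graded_series p G N \<and> (\<Inter>i. N i) = {\<one>\<^bsub>G\<^esub>})"

definition torsion_group :: "('a, 'b) monoid_scheme \<Rightarrow> bool" where
  "torsion_group G \<longleftrightarrow> (\<forall>x\<in>carrier G. \<exists>n>0. x [^]\<^bsub>G\<^esub> (n::nat) = \<one>\<^bsub>G\<^esub>)"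

end

theory Submission
  imports
    Defs
    "HOL-Algebra.Sylow"
    "HOL-Algebra.Weak_Morphisms"
    "HOL-Algebra.Multiplicative_Group"
    "HOL-Library.Countable_Set"
begin

text \<open>Let \<open>F\<close> be free of rank 2 and \<open>g 0, g 1, \<dots>\<close> its elements. Descend from \<open>L = F\<close> by
  replacing \<open>L\<close> with the common kernel of those homomorphisms from \<open>L\<close> to the integers modulo the
  current prime that kill all conjugates of \<open>g k ^ n\<close>, where \<open>n\<close> is the order of \<open>g k\<close> modulo \<open>L\<close>,
  whenever \<open>n > 2 ^ (k + 2)\<close>. If this happens for \<open>g k\<close> at some stage, then \<open>g k ^ n\<close> lies in all
  later terms; otherwise the orders of \<open>g k\<close> stay bounded. So the quotient \<open>Q\<close> of \<open>F\<close> by the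
  intersection of the series is a torsion group.

  If \<open>L\<close> has index \<open>m\<close>, there are \<open>p ^ (m + 1)\<close> homomorphisms from \<open>L\<close> to the integers modulo
  \<open>p\<close>, and the relations cost a factor of at most \<open>p ^ (m / 2)\<close>. A subgroup \<open>K\<close> of \<open>Q\<close> with \<open>d\<close>
  generators in which the image of \<open>L\<close> has index \<open>l\<close> admits at most \<open>p ^ (l (d - 1) + 1)\<close> of them,
  whence \<open>(d - 1) / [Q : K] \<ge> 1 / 2\<close>.

  This applies to all \<open>K\<close> of finite index, provided each contains a term of the series. Since steps
  of a series may be trivial, only the primes \<open>p i\<close> for \<open>i\<close> in an infinite set \<open>A\<close> need be used, and
  \<open>A\<close> can be chosen such that \<open>p\<close> is either injective or constant on it. In both cases the orders
  of the torsion elements in late terms force the inclusion.\<close>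

section \<open>Homomorphisms to the integers modulo \<open>p\<close>\<close>

text \<open>Residues are represented by the integers from 0 to \<open>p - 1\<close>. Extensionality
  makes a function depend only on its values on \<open>H\<close>, so that \<open>card\<close> counts
  homomorphisms.\<close>

definition mod_homs :: "('a, 'b) monoid_scheme \<Rightarrow> 'a set \<Rightarrow> nat \<Rightarrow> ('a \<Rightarrow> int) set" where
  "mod_homs G H p = {\<phi> \<in> H \<rightarrow>\<^sub>E {0..<int p}.
     \<forall>x\<in>H. \<forall>y\<in>H. \<phi> (x \<otimes>\<^bsub>G\<^esub> y) = (\<phi> x + \<phi> y) mod int p}"

definition coset_rep :: "'a set \<Rightarrow> 'a" where
  "coset_rep C = (SOME x. x \<in> C)"

context group
begin

section \<open>Right cosets and their representatives\<close>

lemma rcos_eq_iff: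
  assumes "subgroup H G" "x \<in> carrier G" "y \<in> carrier G"
  shows "H #> x = H #> y \<longleftrightarrow> x \<otimes> inv y \<in> H"
proof -
  interpret subgroup H G by fact
  show ?thesis
    using rcos_module[OF is_group, of y x] repr_independence[of x H y] rcos_self[of x H] assms
    by (metis repr_independenceD)
qed

lemma coset_rep:
  assumes "subgroup H G" "C \<in> rcosets H"
  shows "coset_rep C \<in> carrier G" "H #> coset_rep C = C"
proof -
  obtain x where x: "x \<in> carrier G" "C = H #> x"
    using assms(2) by (auto simp: RCOSETS_def)
  have m: "coset_rep C \<in> C"
    unfolding coset_rep_def using rcos_self[OF x(1) assms(1)] x(2) by (metis someI)
  then show "coset_rep C \<in> carrier G"
    using x r_coset_subset_G[OF subgroup.subset[OF assms(1)] x(1)] by blast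
  show "H #> coset_rep C = C"
    using repr_independence[OF _ x(1) assms(1)] m x(2) by auto
qed

lemma mult_inv_coset_rep:
  assumes "subgroup H G" "x \<in> carrier G"
  shows "x \<otimes> inv (coset_rep (H #> x)) \<in> H"
proof -
  have "H #> x \<in> rcosets H"
    using assms by (auto simp: RCOSETS_def)
  from coset_rep[OF assms(1) this] show ?thesis
    using rcos_eq_iff[OF assms(1) assms(2)] by metis
qed

lemma rcos_mult_left:
  assumes "subgroup H G" "h \<in> H" "x \<in> carrier G"
  shows "H #> (h \<otimes> x) = H #> x"
proof -
  interpret subgroup H G by fact
  show ?thesis
    using assms coset_mult_assoc[of H h x] coset_join2[of h H] subset by (metis mem_carrier)
qed

section \<open>Arithmetic of homomorphisms to the integers modulo \<open>p\<close>\<close>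

lemma mod_homs_mult:
  "\<phi> \<in> mod_homs G H p \<Longrightarrow> x \<in> H \<Longrightarrow> y \<in> H \<Longrightarrow> \<phi> (x \<otimes> y) = (\<phi> x + \<phi> y) mod int p"
  by (auto simp: mod_homs_def)

lemma mod_homs_range:
  "\<phi> \<in> mod_homs G H p \<Longrightarrow> x \<in> H \<Longrightarrow> 0 \<le> \<phi> x \<and> \<phi> x < int p"
  by (auto simp: mod_homs_def PiE_def Pi_def)

lemma mod_homs_mod [simp]:
  "\<phi> \<in> mod_homs G H p \<Longrightarrow> x \<in> H \<Longrightarrow> \<phi> x mod int p = \<phi> x"
  using mod_homs_range by (metis mod_pos_pos_trivial)

lemma mod_homs_ext:
  assumes "\<phi> \<in> mod_homs G H p" "\<psi> \<in> mod_homs G H p" "\<And>x. x \<in> H \<Longrightarrow> \<phi> x = \<psi> x"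
  shows "\<phi> = \<psi>"
  using assms by (auto simp: mod_homs_def intro: PiE_ext)

lemma mod_homs_one:
  assumes "subgroup H G" "\<phi> \<in> mod_homs G H p"
  shows "\<phi> \<one> = 0"
proof -
  have 1: "\<one> \<in> H" using subgroup.one_closed[OF assms(1)] .
  have "\<phi> \<one> = (\<phi> \<one> + \<phi> \<one>) mod int p"
    using mod_homs_mult[OF assms(2) 1 1] by simp
  then have "int p dvd (\<phi> \<one> + \<phi> \<one>) - \<phi> \<one>"
    by (metis mod_eq_dvd_iff mod_homs_mod[OF assms(2) 1])
  then show ?thesis
    using mod_homs_range[OF assms(2) 1] by (auto dest: zdvd_imp_le)
qed

lemma mod_homs_inv:
  assumes "subgroup H G" "\<phi> \<in> mod_homs G H p" "x \<in> H"
  shows "\<phi> (inv x) = (- \<phi> x) mod int p"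
proof -
  have i: "inv x \<in> H" using subgroup.m_inv_closed[OF assms(1,3)] .
  have "x \<in> carrier G" using subgroup.mem_carrier[OF assms(1,3)] .
  then have "(\<phi> (inv x) + \<phi> x) mod int p = 0"
    using mod_homs_mult[OF assms(2) i assms(3)] mod_homs_one[OF assms(1,2)] by simp
  then have "(\<phi> (inv x) + \<phi> x - \<phi> x) mod int p = (0 - \<phi> x) mod int p"
    by (metis mod_diff_left_eq)
  then show ?thesis using assms i by simp
qed

lemma mod_homs_pow:
  assumes "subgroup H G" "\<phi> \<in> mod_homs G H p" "x \<in> H"
  shows "\<phi> (x [^] (n::nat)) = (int n * \<phi> x) mod int p"
proof (induction n)
  case 0
  then show ?case using mod_homs_one[OF assms(1,2)] by simp
next
  case (Suc n)
  have "x [^] n \<in> H"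
    using assms subgroup_int_pow_closed[of H x "int n"] by (simp add: int_pow_int)
  then show ?case
    using mod_homs_mult[OF assms(2) _ assms(3)] Suc by (simp add: mod_simps algebra_simps)
qed

lemma mod_homs_conj:
  assumes "subgroup H G" "\<phi> \<in> mod_homs G H p" "h \<in> H" "x \<in> H"
  shows "\<phi> (inv h \<otimes> x \<otimes> h) = \<phi> x"
proof -
  have i: "inv h \<in> H" using subgroup.m_inv_closed[OF assms(1,3)] .
  have ih: "inv h \<otimes> x \<in> H" using subgroup.m_closed[OF assms(1) i assms(4)] .
  have "\<phi> (inv h \<otimes> x \<otimes> h) = ((- \<phi> h) + \<phi> x + \<phi> h) mod int p"
    using mod_homs_mult[OF assms(2) ih assms(3)] mod_homs_mult[OF assms(2) i assms(4)]
      mod_homs_inv[OF assms(1-3)] by (simp add: mod_simps)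
  then show ?thesis using assms by simp
qed

text \<open>Each \<open>\<phi>\<close> and each choice of values on a transversal yield a function \<open>f\<close> on \<open>G\<close>
  with \<open>f (h x) = \<phi> h + f x\<close>. Up to a constant, \<open>f\<close> is determined by the differences
  \<open>f (x y) - f x\<close> with \<open>y \<in> Y\<close>, which depend only on the coset of \<open>x\<close>.\<close>

lemma card_mod_homs_le:
  assumes H: "subgroup H G" "finite (rcosets H)" and p: "p > 0"
    and U: "U \<subseteq> H" "\<And>x u. x \<in> carrier G \<Longrightarrow> u \<in> U \<Longrightarrow> x \<otimes> u \<otimes> inv x \<in> U"
    and Y: "finite Y" "Y \<subseteq> carrier G" and gen: "generate G (U \<union> Y) = carrier G"
    and \<Phi>: "\<Phi> \<subseteq> mod_homs G H p" "\<And>\<phi> u. \<phi> \<in> \<Phi> \<Longrightarrow> u \<in> U \<Longrightarrow> \<phi> u = 0"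
  shows "card \<Phi> * p ^ card (rcosets H) \<le> p ^ (card (rcosets H) * card Y + 1)"
proof -
  interpret H: subgroup H G by fact
  define t :: "'a set \<Rightarrow> 'a" where "t = coset_rep"
  define f :: "('a \<Rightarrow> int) \<times> ('a set \<Rightarrow> int) \<Rightarrow> 'a \<Rightarrow> int"
    where "f = (\<lambda>(\<phi>, v) x. (\<phi> (x \<otimes> inv (t (H #> x))) + v (H #> x)) mod int p)"
  \<comment> \<open>The choices of values on the transversal; their number is the second factor on
    the left of the claim.\<close>
  define V where "V = rcosets H \<rightarrow>\<^sub>E {0..<int p}"
  define D where "D = ((rcosets H) \<times> Y) \<rightarrow>\<^sub>E {0..<int p}"
  \<comment> \<open>Differences at the representatives determine those at all elements, because a
    left factor \<open>h\<close> adds the same residue to both terms. The value at \<one> fixes the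
    remaining constant and accounts for the \<open>+ 1\<close> in the exponent.\<close>
  define \<Psi> where "\<Psi> = (\<lambda>w. (restrict (\<lambda>(C,y). (f w (t C \<otimes> y) - f w (t C)) mod int p) ((rcosets H) \<times> Y), f w \<one>))"
  have t: "t C \<in> carrier G" "H #> t C = C" if "C \<in> rcosets H" for C
    using coset_rep[OF H(1) that] by (auto simp: t_def)
  have tin: "x \<otimes> inv (t (H #> x)) \<in> H" if "x \<in> carrier G" for x
    using mult_inv_coset_rep[OF H(1) that] by (simp add: t_def)
  have co: "H #> x \<in> rcosets H" if "x \<in> carrier G" for x
    using that by (auto simp: RCOSETS_def)
  have hx: "f (\<phi>,v) (h \<otimes> x) = (\<phi> h + f (\<phi>,v) x) mod int p"
    if "\<phi> \<in> \<Phi>" "h \<in> H" "x \<in> carrier G" for \<phi> v h x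
  proof -
    have "h \<otimes> x \<otimes> inv (t (H #> x)) = h \<otimes> (x \<otimes> inv (t (H #> x)))"
      using that t(1)[OF co] by (simp add: m_assoc)
    then show ?thesis
      using that rcos_mult_left[OF H(1) that(2,3)] mod_homs_mult[OF subsetD[OF \<Phi>(1) that(1)] that(2) tin[OF that(3)]]
      by (simp add: f_def mod_simps add.assoc)
  qed
  have ft: "f (\<phi>,v) (t C) = v C" if "\<phi> \<in> \<Phi>" "v \<in> V" "C \<in> rcosets H" for \<phi> v C
    using that t[OF that(3)] mod_homs_one[OF H(1) subsetD[OF \<Phi>(1) that(1)]]
    by (auto simp: f_def V_def PiE_def Pi_def)
  have inj: "inj_on \<Psi> (\<Phi> \<times> V)"
  proof (rule inj_onI, clarsimp)
    fix \<phi> v \<phi>' v'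
    assume w: "\<phi> \<in> \<Phi>" "v \<in> V" "\<phi>' \<in> \<Phi>" "v' \<in> V" and eq: "\<Psi> (\<phi>,v) = \<Psi> (\<phi>',v')"
    define g where "g x = (f (\<phi>,v) x - f (\<phi>',v') x) mod int p" for x
    have fm: "f w x mod int p = f w x" for w x by (cases w) (simp add: f_def)
    have d: "(f (\<phi>,v) (t C \<otimes> y) - f (\<phi>,v) (t C)) mod int p = (f (\<phi>',v') (t C \<otimes> y) - f (\<phi>',v') (t C)) mod int p"
      if "C \<in> rcosets H" "y \<in> Y" for C y
    proof -
      have "fst (\<Psi> (\<phi>,v)) (C,y) = fst (\<Psi> (\<phi>',v')) (C,y)" using eq by simp
      then show ?thesis using that by (simp add: \<Psi>_def)
    qed
    have gh: "g (h \<otimes> x) = ((\<phi> h - \<phi>' h) + g x) mod int p" if "h \<in> H" "x \<in> carrier G" for h x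
    proof -
      have "g (h \<otimes> x) = (\<phi> h + f (\<phi>,v) x - (\<phi>' h + f (\<phi>',v') x)) mod int p"
        using hx[OF w(1) that, of v] hx[OF w(3) that, of v'] by (simp add: g_def mod_simps)
      also have "\<dots> = ((\<phi> h - \<phi>' h) + (f (\<phi>,v) x - f (\<phi>',v') x)) mod int p"
        by (simp add: algebra_simps)
      finally show ?thesis by (simp add: g_def mod_add_right_eq)
    qed
    \<comment> \<open>The right periods of the difference \<open>g\<close> of two extensions with
      equal data form a subgroup. It contains \<open>Y\<close> because the recorded differences
      agree, and \<open>U\<close> because
      \<open>x \<otimes> u = (x \<otimes> u \<otimes> inv x) \<otimes> x\<close>, where both
      homomorphisms vanish on the conjugate. So \<open>g\<close> is constant.\<close>
    define Z where "Z = {z \<in> carrier G. \<forall>x\<in>carrier G. g (x \<otimes> z) = g x}"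
    have Zsub: "subgroup Z G"
    proof (rule subgroupI)
      show "Z \<subseteq> carrier G" by (auto simp: Z_def)
      have "\<one> \<in> Z" by (auto simp: Z_def)
      then show "Z \<noteq> {}" by blast
    next
      fix a assume a: "a \<in> Z"
      then have ac: "a \<in> carrier G" by (auto simp: Z_def)
      have "g (x \<otimes> inv a) = g x" if "x \<in> carrier G" for x
      proof -
        have "g (x \<otimes> inv a \<otimes> a) = g (x \<otimes> inv a)" using a that ac by (auto simp: Z_def)
        then show ?thesis using that ac by (simp add: m_assoc)
      qed
      then show "inv a \<in> Z" using ac by (auto simp: Z_def)
    next
      fix a b assume "a \<in> Z" "b \<in> Z"
      then show "a \<otimes> b \<in> Z" by (auto simp: Z_def m_assoc[symmetric])
    qed
    have "U \<subseteq> Z"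
    proof
      fix u assume u: "u \<in> U"
      have uc: "u \<in> carrier G" using u U(1) H.subset by blast
      have "g (x \<otimes> u) = g x" if x: "x \<in> carrier G" for x
      proof -
        have c: "x \<otimes> u \<otimes> inv x \<in> U" using U(2)[OF x u] .
        have "x \<otimes> u = (x \<otimes> u \<otimes> inv x) \<otimes> x" using x uc by (simp add: m_assoc)
        then have "g (x \<otimes> u) = ((\<phi> (x \<otimes> u \<otimes> inv x) - \<phi>' (x \<otimes> u \<otimes> inv x)) + g x) mod int p"
          using gh[OF _ x, of "x \<otimes> u \<otimes> inv x"] c U(1) by auto
        then show ?thesis using \<Phi>(2)[OF w(1) c] \<Phi>(2)[OF w(3) c] by (simp add: g_def)
      qed
      then show "u \<in> Z" using uc by (auto simp: Z_def)
    qed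
    moreover have "Y \<subseteq> Z"
    proof
      fix y assume y: "y \<in> Y"
      have yc: "y \<in> carrier G" using y Y by blast
      have "g (x \<otimes> y) = g x" if x: "x \<in> carrier G" for x
      proof -
        define C where "C = H #> x"
        define h where "h = x \<otimes> inv (t C)"
        have C: "C \<in> rcosets H" using co[OF x] by (simp add: C_def)
        have h: "h \<in> H" using tin[OF x] by (simp add: h_def C_def)
        have x': "x = h \<otimes> t C" using x t(1)[OF C] by (simp add: h_def m_assoc)
        have "g (t C \<otimes> y) = g (t C)"
        proof -
          have "(f (\<phi>,v) (t C \<otimes> y) - f (\<phi>,v) (t C) + (f (\<phi>,v) (t C) - f (\<phi>',v') (t C \<otimes> y))) mod int p
             = (f (\<phi>',v') (t C \<otimes> y) - f (\<phi>',v') (t C) + (f (\<phi>,v) (t C) - f (\<phi>',v') (t C \<otimes> y))) mod int p"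
            using d[OF C y] by (metis mod_add_left_eq)
          then show ?thesis by (simp add: g_def)
        qed
        moreover have "x \<otimes> y = h \<otimes> (t C \<otimes> y)" using x' h t(1)[OF C] yc by (metis m_assoc H.mem_carrier)
        ultimately show ?thesis using gh[OF h] t(1)[OF C] yc x' by simp
      qed
      then show "y \<in> Z" using yc by (auto simp: Z_def)
    qed
    ultimately have "carrier G \<subseteq> Z"
      using generate_subgroup_incl[OF _ Zsub, of "U \<union> Y"] gen by simp
    moreover have g1: "g \<one> = 0"
      using eq by (simp add: \<Psi>_def g_def)
    ultimately have g0: "g x = 0" if "x \<in> carrier G" for x
      using that by (auto simp: Z_def dest!: subsetD[of _ _ x] bspec[of _ _ \<one>])
    have ff: "f (\<phi>,v) x = f (\<phi>',v') x" if "x \<in> carrier G" for x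
    proof -
      have "int p dvd f (\<phi>,v) x - f (\<phi>',v') x" using g0[OF that] by (simp add: g_def mod_0_imp_dvd)
      then show ?thesis using fm by (metis mod_eq_dvd_iff)
    qed
    have vv: "v = v'"
      using w(2,4) unfolding V_def
    proof (rule PiE_ext)
      fix C assume "C \<in> rcosets H"
      then show "v C = v' C" using ff[OF t(1)] ft w by metis
    qed
    moreover have "\<phi> = \<phi>'"
    proof (rule mod_homs_ext[OF subsetD[OF \<Phi>(1) w(1)] subsetD[OF \<Phi>(1) w(3)]])
      fix h assume h: "h \<in> H"
      have "0 = (\<phi> h - \<phi>' h) mod int p" using gh[OF h one_closed] g0[of h] g1 h by simp
      then have "int p dvd \<phi> h - \<phi>' h" by (simp add: mod_0_imp_dvd)
      then show "\<phi> h = \<phi>' h" using mod_homs_mod[OF subsetD[OF \<Phi>(1) w(1)] h] mod_homs_mod[OF subsetD[OF \<Phi>(1) w(3)] h]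
        by (metis mod_eq_dvd_iff)
    qed
    ultimately show "\<phi> = \<phi>' \<and> v = v'" by blast
  qed
  have "\<Psi> ` (\<Phi> \<times> V) \<subseteq> D \<times> {0..<int p}"
    using p by (auto simp: \<Psi>_def D_def f_def split: if_splits)
  moreover have "finite (D \<times> {0..<int p})"
    using H(2) Y(1) by (auto simp: D_def intro!: finite_PiE)
  ultimately have "card (\<Phi> \<times> V) \<le> card (D \<times> {0..<int p})"
    by (rule card_inj_on_le[OF inj])
  moreover have "card V = p ^ card (rcosets H)"
    using H(2) by (simp add: V_def card_PiE)
  moreover have "card D = p ^ (card (rcosets H) * card Y)"
    using H(2) Y(1) by (simp add: D_def card_PiE card_cartesian_product)
  ultimately show ?thesis by (simp add: card_cartesian_product mult.commute)
qed

text \<open>The analogue of the fact that \<open>card Y\<close> linear conditions lower a dimension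
  by at most \<open>card Y\<close>. Restriction to \<open>Y\<close> takes at most
  \<open>p ^ card Y\<close> values, and subtracting a fixed member embeds each of its fibres in the
  set of homomorphisms vanishing on \<open>Y\<close>.\<close>

lemma card_mod_homs_vanishing:
  assumes H: "subgroup H G" and p: "p > 0" and Y: "finite Y" "Y \<subseteq> H"
    and fin: "finite (mod_homs G H p)"
  shows "card (mod_homs G H p) \<le> card {\<phi> \<in> mod_homs G H p. \<forall>y\<in>Y. \<phi> y = 0} * p ^ card Y"
proof -
  let ?M = "mod_homs G H p" and ?N = "{\<phi> \<in> mod_homs G H p. \<forall>y\<in>Y. \<phi> y = 0}"
  define r where "r = (\<lambda>\<phi>::'a\<Rightarrow>int. restrict \<phi> Y)"
  have B: "r ` ?M \<subseteq> Y \<rightarrow>\<^sub>E {0..<int p}"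
    using Y(2) mod_homs_range by (fastforce simp: r_def)
  have finB: "finite (Y \<rightarrow>\<^sub>E {0..<int p})" using Y by (auto intro: finite_PiE)
  have fib: "card {\<phi> \<in> ?M. r \<phi> = b} \<le> card ?N" if b: "b \<in> r ` ?M" for b
  proof -
    obtain \<psi> where \<psi>: "\<psi> \<in> ?M" "r \<psi> = b" using b by blast
    define T where "T \<phi> = restrict (\<lambda>x. (\<phi> x - \<psi> x) mod int p) H" for \<phi> :: "'a \<Rightarrow> int"
    show ?thesis
    proof (rule card_inj_on_le)
      show "inj_on T {\<phi> \<in> ?M. r \<phi> = b}"
      proof (rule inj_onI, clarsimp)
        fix \<phi> \<phi>' assume h: "\<phi> \<in> ?M" "\<phi>' \<in> ?M" "T \<phi> = T \<phi>'"
        show "\<phi> = \<phi>'"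
        proof (rule mod_homs_ext[OF h(1,2)])
          fix x assume x: "x \<in> H"
          have "(\<phi> x - \<psi> x) mod int p = (\<phi>' x - \<psi> x) mod int p"
            using fun_cong[OF h(3), of x] x by (simp add: T_def)
          then have "(\<phi> x - \<psi> x + \<psi> x) mod int p = (\<phi>' x - \<psi> x + \<psi> x) mod int p"
            by (metis mod_add_left_eq)
          then show "\<phi> x = \<phi>' x" using h x by simp
        qed
      qed
      show "T ` {\<phi> \<in> ?M. r \<phi> = b} \<subseteq> ?N"
      proof clarsimp
        fix \<phi> assume h: "\<phi> \<in> ?M" "b = r \<phi>"
        have "T \<phi> y = 0" if "y \<in> Y" for y
        proof -
          have "r \<phi> y = r \<psi> y" using h(2) \<psi>(2) by simp
          then have "\<phi> y = \<psi> y" using that by (simp add: r_def)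
          then show ?thesis using that Y(2) by (auto simp: T_def)
        qed
        moreover have "T \<phi> \<in> ?M"
          unfolding mod_homs_def
        proof (intro CollectI conjI ballI)
          show "T \<phi> \<in> H \<rightarrow>\<^sub>E {0..<int p}" using p by (auto simp: T_def)
          fix x y assume "x \<in> H" "y \<in> H"
          then have "T \<phi> (x \<otimes> y) = (\<phi> x + \<phi> y - (\<psi> x + \<psi> y)) mod int p"
            and "T \<phi> x + T \<phi> y = (\<phi> x - \<psi> x) mod int p + (\<phi> y - \<psi> y) mod int p"
            using h(1) \<psi>(1) subgroup.m_closed[OF H] mod_homs_mult[of \<phi> H p x y] mod_homs_mult[of \<psi> H p x y]
            by (simp_all add: T_def mod_simps)
          then show "T \<phi> (x \<otimes> y) = (T \<phi> x + T \<phi> y) mod int p"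
            by (simp only: mod_add_eq) (simp add: algebra_simps)
        qed
        ultimately show "T \<phi> \<in> ?M \<and> (\<forall>y\<in>Y. T \<phi> y = 0)" by blast
      qed
      show "finite ?N" using fin by auto
    qed
  qed
  have "?M = (\<Union>b\<in>r ` ?M. {\<phi> \<in> ?M. r \<phi> = b})" by blast
  then have "card ?M \<le> (\<Sum>b\<in>r ` ?M. card {\<phi> \<in> ?M. r \<phi> = b})"
    using card_UN_le[of "r ` ?M" "\<lambda>b. {\<phi> \<in> ?M. r \<phi> = b}"] fin by (metis finite_imageI)
  also have "\<dots> \<le> card (r ` ?M) * card ?N"
    using sum_bounded_above[of "r ` ?M" _ "card ?N"] fib by (simp add: mult.commute)
  also have "\<dots> \<le> card (Y \<rightarrow>\<^sub>E {0..<int p}) * card ?N"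
    using card_mono[OF finB B] by simp
  finally show ?thesis using Y by (simp add: card_PiE mult.commute)
qed

end

section \<open>A free group of rank two\<close>

text \<open>The left factor of a product is applied first, so that evaluation at a coordinate is a
  right action, like multiplication on right cosets.\<close>

definition perm_families :: "((bool \<Rightarrow> nat \<Rightarrow> nat) \<Rightarrow> nat \<Rightarrow> nat) monoid" where
  "perm_families = \<lparr>carrier = {f. \<forall>\<sigma>. bij (f \<sigma>)}, monoid.mult = (\<lambda>f g \<sigma>. g \<sigma> \<circ> f \<sigma>), one = (\<lambda>\<sigma>. id)\<rparr>"

text \<open>The index \<sigma> is an arbitrary pair of functions; the default \<open>id\<close> at
  components that are not permutations keeps the generator in \<open>perm_families\<close>.\<close>

definition free_gen :: "bool \<Rightarrow> (bool \<Rightarrow> nat \<Rightarrow> nat) \<Rightarrow> nat \<Rightarrow> nat" where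
  "free_gen b = (\<lambda>\<sigma>. if bij (\<sigma> b) then \<sigma> b else id)"

text \<open>The free group on two generators, as the group generated by the coordinate functions inside
  the product, over all pairs \<open>\<sigma>\<close> of permutations of the naturals, of copies of the
  symmetric group. The universal property with respect to permutation groups is thus immediate.\<close>

definition free_group2 :: "((bool \<Rightarrow> nat \<Rightarrow> nat) \<Rightarrow> nat \<Rightarrow> nat) monoid" where
  "free_group2 = perm_families\<lparr>carrier := generate perm_families (range free_gen)\<rparr>"

lemma group_perm_families: "group perm_families"
proof (rule groupI)
  fix x assume x: "x \<in> carrier perm_families"
  have "(\<lambda>\<sigma>. Hilbert_Choice.inv (x \<sigma>)) \<otimes>\<^bsub>perm_families\<^esub> x = \<one>\<^bsub>perm_families\<^esub>"
    using x by (auto simp: perm_families_def fun_eq_iff bij_def surj_f_inv_f)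
  moreover have "(\<lambda>\<sigma>. Hilbert_Choice.inv (x \<sigma>)) \<in> carrier perm_families"
    using x by (auto simp: perm_families_def bij_imp_bij_inv)
  ultimately show "\<exists>y\<in>carrier perm_families. y \<otimes>\<^bsub>perm_families\<^esub> x = \<one>\<^bsub>perm_families\<^esub>" by blast
qed (auto simp: perm_families_def bij_comp fun_eq_iff)

lemma free_gen_carrier: "range free_gen \<subseteq> carrier perm_families"
  by (auto simp: free_gen_def perm_families_def)

lemma subgroup_free: "subgroup (generate perm_families (range free_gen)) perm_families"
  using group.generate_is_subgroup[OF group_perm_families free_gen_carrier] .

lemma group_free_group2: "group free_group2"
  unfolding free_group2_def using subgroup.subgroup_is_group[OF subgroup_free group_perm_families] .

lemma free_gen_in: "free_gen b \<in> carrier free_group2"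
  by (simp add: free_group2_def generate.incl)

lemma generate_free_gen: "generate free_group2 (range free_gen) = carrier free_group2"
proof -
  have "range free_gen \<subseteq> generate perm_families (range free_gen)"
    by (auto intro: generate.incl)
  from group.generate_consistent[OF group_perm_families this subgroup_free] show ?thesis
    by (simp add: free_group2_def)
qed

text \<open>Any two permutations of a finite set are the images of the generators under a right
  action. The set is coded in the naturals by \<open>e\<close>, the permutations are extended by the
  identity to a pair \<sigma>, and the action is evaluation at the coordinate \<sigma>.\<close>

lemma free_group2_action:
  fixes X :: "'x set" and \<tau> :: "bool \<Rightarrow> 'x \<Rightarrow> 'x"
  assumes fin: "finite X" and \<tau>: "\<And>b. bij_betw (\<tau> b) X X"
  obtains \<alpha> where
    "\<And>f z. f \<in> carrier free_group2 \<Longrightarrow> z \<in> X \<Longrightarrow> \<alpha> f z \<in> X"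
    "\<And>z. z \<in> X \<Longrightarrow> \<alpha> \<one>\<^bsub>free_group2\<^esub> z = z"
    "\<And>f g z. f \<in> carrier free_group2 \<Longrightarrow> g \<in> carrier free_group2 \<Longrightarrow> z \<in> X \<Longrightarrow>
       \<alpha> (f \<otimes>\<^bsub>free_group2\<^esub> g) z = \<alpha> g (\<alpha> f z)"
    "\<And>b z. z \<in> X \<Longrightarrow> \<alpha> (free_gen b) z = \<tau> b z"
proof -
  define e where "e = to_nat_on X"
  define d where "d = inv_into X e"
  have inj: "inj_on e X" unfolding e_def by (rule inj_on_to_nat_on[OF countable_finite[OF fin]])
  have de: "d (e z) = z" if "z \<in> X" for z
    using that inj by (simp add: d_def)
  have ed: "e (d n) = n" "d n \<in> X" if "n \<in> e ` X" for n
    using that by (auto simp: d_def f_inv_into_f inv_into_into)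
  define \<sigma> where "\<sigma> b n = (if n \<in> e ` X then e (\<tau> b (d n)) else n)" for b n
  have tX: "\<tau> b z \<in> X" if "z \<in> X" for b z
    using \<tau> that by (auto simp: bij_betw_def)
  have \<sigma>X: "\<sigma> b ` (e ` X) = e ` X" for b
  proof
    show "\<sigma> b ` (e ` X) \<subseteq> e ` X" using tX by (auto simp: \<sigma>_def de)
    show "e ` X \<subseteq> \<sigma> b ` (e ` X)"
    proof clarify
      fix z assume z: "z \<in> X"
      then obtain y where "y \<in> X" "z = \<tau> b y" using \<tau>[of b] by (auto simp: bij_betw_def)
      then have "e z = \<sigma> b (e y)" by (simp add: \<sigma>_def de)
      then show "e z \<in> \<sigma> b ` (e ` X)" using \<open>y \<in> X\<close> by blast
    qed
  qed
  have "bij_betw (\<sigma> b) (e ` X) (e ` X)" for b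
    using \<sigma>X[of b] fin by (simp add: bij_betw_def eq_card_imp_inj_on)
  moreover have "bij_betw (\<sigma> b) (- e ` X) (- e ` X)" for b
    by (subst bij_betw_cong[of _ _ id]) (auto simp: \<sigma>_def bij_betw_def)
  ultimately have bij\<sigma>: "bij (\<sigma> b)" for b
    using bij_betw_combine[of "\<sigma> b" "e ` X" "e ` X" "- e ` X" "- e ` X"] by auto
  \<comment> \<open>The coded copy of \<open>X\<close> must be stable under all elements, since
    \<open>d\<close> decodes only numbers from that copy.\<close>
  have inv_X: "f \<sigma> ` (e ` X) = e ` X" if "f \<in> generate perm_families (range free_gen)" for f
    using that
  proof (induction rule: generate.induct)
    case one
    then show ?case by (simp add: perm_families_def)
  next
    case (incl h)
    then obtain b where "h = free_gen b" by blast
    then show ?case using bij\<sigma>[of b] \<sigma>X[of b] by (simp add: free_gen_def)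
  next
    case (inv h)
    then obtain b where h: "h = free_gen b" by blast
    have hc: "h \<in> carrier perm_families" using free_gen_carrier h by auto
    have c: "(\<lambda>\<sigma>. Hilbert_Choice.inv (h \<sigma>)) \<in> carrier perm_families"
      using hc by (simp add: perm_families_def bij_imp_bij_inv)
    have "inv\<^bsub>perm_families\<^esub> h = (\<lambda>\<sigma>. Hilbert_Choice.inv (h \<sigma>))"
      using c hc
      by (intro group.inv_equality[OF group_perm_families])
        (auto simp: perm_families_def fun_eq_iff bij_def surj_f_inv_f)
    then have "(inv\<^bsub>perm_families\<^esub> h) \<sigma> ` (e ` X) = Hilbert_Choice.inv (\<sigma> b) ` (\<sigma> b ` (e ` X))"
      using \<sigma>X[of b] h bij\<sigma> by (simp add: free_gen_def)
    also have "\<dots> = e ` X" using bij\<sigma>[of b] by (simp add: bij_def)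
    finally show ?case .
  next
    case (eng h1 h2)
    have "(h1 \<otimes>\<^bsub>perm_families\<^esub> h2) \<sigma> ` (e ` X) = h2 \<sigma> ` (h1 \<sigma> ` (e ` X))"
      by (auto simp: perm_families_def)
    then show ?case using eng by simp
  qed
  have inX: "f \<sigma> (e z) \<in> e ` X" if "f \<in> carrier free_group2" "z \<in> X" for f z
    using inv_X[of f] that by (auto simp: free_group2_def)
  show thesis
  proof (rule that[of "\<lambda>f z. d (f \<sigma> (e z))"])
    fix f z assume "f \<in> carrier free_group2" "z \<in> X"
    then show "d (f \<sigma> (e z)) \<in> X" using inX ed by blast
  next
    fix z assume "z \<in> X"
    then show "d (\<one>\<^bsub>free_group2\<^esub> \<sigma> (e z)) = z"
      by (simp add: free_group2_def perm_families_def de)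
  next
    fix f g z assume "f \<in> carrier free_group2" "g \<in> carrier free_group2" "z \<in> X"
    then show "d ((f \<otimes>\<^bsub>free_group2\<^esub> g) \<sigma> (e z)) = d (g \<sigma> (e (d (f \<sigma> (e z)))))"
      using ed(1)[OF inX] by (simp add: free_group2_def perm_families_def)
  next
    fix b z assume "z \<in> X"
    then show "d (free_gen b \<sigma> (e z)) = \<tau> b z"
      using bij\<sigma>[of b] tX by (simp add: free_gen_def \<sigma>_def de)
  qed
qed

text \<open>Every element is the value of a word in the generators and their inverses. This provides
  the enumeration of the free group from which the series is built.\<close>

lemma (in group) countable_generate:
  assumes "countable A" "A \<subseteq> carrier G"
  shows "countable (generate G A)"
proof -
  let ?B = "A \<union> (\<lambda>x. inv x) ` A"
  let ?w = "foldr (\<lambda>x y. x \<otimes> y)"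
  have B: "?B \<subseteq> carrier G" using assms(2) by auto
  have wc: "?w l \<one> \<in> carrier G" if "set l \<subseteq> ?B" for l
    using that B by (induction l) auto
  have app: "?w (l @ l') \<one> = ?w l \<one> \<otimes> ?w l' \<one>" if "set l \<subseteq> ?B" "set l' \<subseteq> ?B" for l l'
    using that(1)
  proof (induction l)
    case Nil
    then show ?case using wc[OF that(2)] by simp
  next
    case (Cons a l)
    then show ?case using wc[of l] wc[OF that(2)] B by (auto simp: m_assoc)
  qed
  have "generate G A \<subseteq> (\<lambda>l. ?w l \<one>) ` lists ?B"
  proof
    fix x assume "x \<in> generate G A"
    then show "x \<in> (\<lambda>l. ?w l \<one>) ` lists ?B"
    proof (induction rule: generate.induct)
      case one
      show ?case by (rule image_eqI[of _ _ "[]"]) auto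
    next
      case (incl h)
      then show ?case using B by (intro image_eqI[of _ _ "[h]"]) auto
    next
      case (inv h)
      then show ?case using B by (intro image_eqI[of _ _ "[inv h]"]) auto
    next
      case (eng h1 h2)
      then obtain l1 l2 where "l1 \<in> lists ?B" "l2 \<in> lists ?B" "h1 = ?w l1 \<one>" "h2 = ?w l2 \<one>"
        by blast
      moreover from this have "set l1 \<subseteq> ?B" "set l2 \<subseteq> ?B" by (simp_all add: lists_eq_set)
      ultimately show ?case using app[of l1 l2]
        by (intro image_eqI[of _ _ "l1 @ l2"]) (simp_all only: append_in_lists_conv)
    qed
  qed
  then show ?thesis
    using assms(1) by (meson countable_Un countable_image countable_lists countable_subset)
qed

text \<open>Values \<open>c\<close> on pairs of a coset and a generator make \<open>G\<close> act on
  \<open>(rcosets H) \<times> {0..<p}\<close>; the second coordinate of the orbit map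
  is a function \<open>f\<close> with \<open>f (h x) = f h + f x - f 1\<close> for \<open>h \<in> H\<close>.\<close>

lemma card_mod_homs_free_group2:
  assumes H: "subgroup H free_group2" "finite (rcosets\<^bsub>free_group2\<^esub> H)" and p: "p > 0"
    and fin: "finite (mod_homs free_group2 H p)"
  shows "p ^ (card (rcosets\<^bsub>free_group2\<^esub> H) + 1) \<le> card (mod_homs free_group2 H p)"
proof -
  interpret group free_group2 by (rule group_free_group2)
  interpret H: subgroup H free_group2 by fact
  note [simp] = free_gen_in
  let ?G = free_group2
  define R where "R = rcosets\<^bsub>?G\<^esub> H"
  have finR: "finite R" using H by (simp add: R_def)
  define D where "D = (R \<times> (UNIV::bool set)) \<rightarrow>\<^sub>E {0..<int p}"
  define V where "V = R \<rightarrow>\<^sub>E {0..<int p}"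
  define X where "X = R \<times> {0..<int p}"
  define \<tau> where "\<tau> c b = (\<lambda>(C, a). (C #>\<^bsub>?G\<^esub> free_gen b, (a + c (C, b)) mod int p))" for c :: "_ \<times> bool \<Rightarrow> int" and b
  have co: "H #>\<^bsub>?G\<^esub> x \<in> R" if "x \<in> carrier ?G" for x
    using that by (auto simp: R_def RCOSETS_def)
  have coR: "C #>\<^bsub>?G\<^esub> x \<in> R" if "C \<in> R" "x \<in> carrier ?G" for C x
  proof -
    obtain y where y: "y \<in> carrier ?G" "C = H #>\<^bsub>?G\<^esub> y" using \<open>C \<in> R\<close> by (auto simp: R_def RCOSETS_def)
    then show ?thesis using that co coset_mult_assoc[OF H.subset y(1) that(2)] by simp
  qed
  have Rsub: "C \<subseteq> carrier ?G" if "C \<in> R" for C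
    using that H.rcosets_carrier by (auto simp: R_def)
  have bij: "bij_betw (\<tau> c b) X X" for c b
  proof -
    have "inj_on (\<tau> c b) X"
    proof (rule inj_onI)
      fix u w assume u: "u \<in> X" and w: "w \<in> X" and eq: "\<tau> c b u = \<tau> c b w"
      obtain C a C' a' where [simp]: "u = (C,a)" "w = (C',a')" by (cases u, cases w)
      have C: "C \<in> R" "C' \<in> R" and a: "0 \<le> a" "a < int p" "0 \<le> a'" "a' < int p"
        using u w by (auto simp: X_def)
      have "C #>\<^bsub>?G\<^esub> free_gen b #>\<^bsub>?G\<^esub> inv\<^bsub>?G\<^esub> free_gen b = C' #>\<^bsub>?G\<^esub> free_gen b #>\<^bsub>?G\<^esub> inv\<^bsub>?G\<^esub> free_gen b"
        using eq by (simp add: \<tau>_def)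
      then have CC: "C = C'"
        using coset_mult_assoc[OF Rsub[OF C(1)], of "free_gen b" "inv\<^bsub>?G\<^esub> free_gen b"]
          coset_mult_assoc[OF Rsub[OF C(2)], of "free_gen b" "inv\<^bsub>?G\<^esub> free_gen b"] Rsub C
        by simp
      then have "(a + c (C,b)) mod int p = (a' + c (C,b)) mod int p"
        using eq by (simp add: \<tau>_def)
      then have "int p dvd a - a'" by (simp add: mod_eq_dvd_iff)
      then have "a mod int p = a' mod int p" by (simp add: mod_eq_dvd_iff)
      then show "u = w" using CC a by simp
    qed
    moreover have "\<tau> c b ` X \<subseteq> X"
      using coR p by (auto simp: \<tau>_def X_def)
    moreover have "finite X" using finR by (simp add: X_def)
    ultimately show ?thesis by (simp add: bij_betw_def endo_inj_surj)
  qed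
  define act where "act c \<alpha> \<longleftrightarrow>
    (\<forall>f\<in>carrier ?G. \<forall>z\<in>X. \<alpha> f z \<in> X) \<and> (\<forall>z\<in>X. \<alpha> \<one>\<^bsub>?G\<^esub> z = z) \<and>
    (\<forall>f\<in>carrier ?G. \<forall>g\<in>carrier ?G. \<forall>z\<in>X. \<alpha> (f \<otimes>\<^bsub>?G\<^esub> g) z = \<alpha> g (\<alpha> f z)) \<and>
    (\<forall>b. \<forall>z\<in>X. \<alpha> (free_gen b) z = \<tau> c b z)" for c \<alpha>
  have finX: "finite X" using finR by (simp add: X_def)
  have "\<exists>\<alpha>. act c \<alpha>" for c
    by (rule free_group2_action[where \<tau> = "\<tau> c", OF finX bij]) (unfold act_def, blast)
  then obtain \<alpha> where \<alpha>: "act c (\<alpha> c)" for c by metis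
  have ain: "\<alpha> c f z \<in> X" if "f \<in> carrier ?G" "z \<in> X" for c f z using \<alpha>[of c] that by (simp add: act_def)
  have a1: "\<alpha> c \<one>\<^bsub>?G\<^esub> z = z" if "z \<in> X" for c z using \<alpha>[of c] that by (simp add: act_def)
  have am: "\<alpha> c (f \<otimes>\<^bsub>?G\<^esub> g) z = \<alpha> c g (\<alpha> c f z)" if "f \<in> carrier ?G" "g \<in> carrier ?G" "z \<in> X" for c f g z
    using \<alpha>[of c] that by (simp add: act_def)
  have ag: "\<alpha> c (free_gen b) z = \<tau> c b z" if "z \<in> X" for c b z using \<alpha>[of c] that by (simp add: act_def)
  \<comment> \<open>Translation of the second coordinate commutes with the action. As
    \<open>h \<in> H\<close> fixes the coset \<open>H\<close>, it moves \<open>(H, a0)\<close> by a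
    translation, and this yields the additivity \<open>fh\<close>.\<close>
  define sh where "sh k = (\<lambda>(C::((bool \<Rightarrow> nat \<Rightarrow> nat) \<Rightarrow> nat \<Rightarrow> nat) set, a::int). (C, (a + k) mod int p))" for k
  have shX: "sh k z \<in> X" if "z \<in> X" for k z using that p by (auto simp: sh_def X_def)
  define good where "good c x \<longleftrightarrow> (\<forall>z\<in>X. fst (\<alpha> c x z) = fst z #>\<^bsub>?G\<^esub> x \<and> (\<forall>k. \<alpha> c x (sh k z) = sh k (\<alpha> c x z)))" for c x
  have good: "good c x" if "x \<in> generate ?G (range free_gen)" for c x
    using that
  proof (induction rule: generate.induct)
    case one
    then show ?case using Rsub shX by (auto simp: good_def a1 X_def)
  next
    case (incl h)
    then obtain b where h: "h = free_gen b" by blast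
    have "\<tau> c b (sh k z) = sh k (\<tau> c b z)" for k z
      by (cases z) (simp add: \<tau>_def sh_def mod_simps algebra_simps)
    then show ?case using h shX by (auto simp: good_def ag) (auto simp: \<tau>_def)
  next
    case (inv h)
    then obtain b where h: "h = free_gen b" by blast
    let ?i = "inv\<^bsub>?G\<^esub> free_gen b"
    have gi: "\<alpha> c h (\<alpha> c ?i z) = z" if "z \<in> X" for z
      using am[of ?i "free_gen b" z c] that a1 by (simp add: h)
    have ig: "\<alpha> c ?i (\<alpha> c h z) = z" if "z \<in> X" for z
      using am[of "free_gen b" ?i z c] that a1 by (simp add: h)
    have gh: "fst (\<alpha> c h z) = fst z #>\<^bsub>?G\<^esub> free_gen b" "\<alpha> c h (sh k z) = sh k (\<alpha> c h z)" if "z \<in> X" for k z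
      using ag[OF that] ag[OF shX[OF that]] that h
      by (cases z; simp add: \<tau>_def sh_def mod_simps algebra_simps)+
    show ?case
      unfolding good_def h
    proof (intro ballI conjI allI)
      fix z assume z: "z \<in> X"
      define y where "y = \<alpha> c ?i z"
      have y: "y \<in> X" using ain z by (simp add: y_def)
      have z': "z = \<alpha> c h y" using gi[OF z] by (simp add: y_def)
      have fy: "fst y \<subseteq> carrier ?G" using y by (simp add: X_def mem_Times_iff Rsub)
      have "fst z #>\<^bsub>?G\<^esub> ?i = fst y"
        using gh(1)[OF y] coset_mult_assoc[OF fy, of "free_gen b" ?i] fy by (simp add: z')
      then show "fst (\<alpha> c ?i z) = fst z #>\<^bsub>?G\<^esub> ?i" by (simp add: y_def)
      fix k
      show "\<alpha> c ?i (sh k z) = sh k (\<alpha> c ?i z)"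
        using ig[OF shX[OF y], of k] gh(2)[OF y, of k] ig[OF y] by (simp add: z')
    qed
  next
    case (eng h1 h2)
    then have h: "h1 \<in> carrier ?G" "h2 \<in> carrier ?G" using generate_free_gen by auto
    show ?case
      unfolding good_def
    proof (intro ballI conjI allI)
      fix z k assume z: "z \<in> X"
      have z1: "\<alpha> c h1 z \<in> X" using ain[OF h(1) z] .
      have "fst z \<subseteq> carrier ?G" using z by (simp add: X_def mem_Times_iff Rsub)
      then show "fst (\<alpha> c (h1 \<otimes>\<^bsub>?G\<^esub> h2) z) = fst z #>\<^bsub>?G\<^esub> (h1 \<otimes>\<^bsub>?G\<^esub> h2)"
        using eng.IH z z1 h by (simp add: good_def am coset_mult_assoc)
      show "\<alpha> c (h1 \<otimes>\<^bsub>?G\<^esub> h2) (sh k z) = sh k (\<alpha> c (h1 \<otimes>\<^bsub>?G\<^esub> h2) z)"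
        using eng.IH z z1 h shX[OF z, of k] by (simp add: good_def am)
    qed
  qed
  define f where "f = (\<lambda>(c, a0) x. snd (\<alpha> c x (H, a0)))"
  have HX: "(H, a0) \<in> X" if "a0 \<in> {0..<int p}" for a0
    using that H.subgroup_in_rcosets[OF is_group] by (auto simp: X_def R_def)
  have f1: "f (c,a0) \<one>\<^bsub>?G\<^esub> = a0" if "a0 \<in> {0..<int p}" for c a0
    using a1[OF HX[OF that]] by (simp add: f_def)
  have fr: "f (c,a0) x \<in> {0..<int p}" if "a0 \<in> {0..<int p}" "x \<in> carrier ?G" for c a0 x
    using ain[OF that(2) HX[OF that(1)], of c] by (auto simp: f_def X_def)
  have av: "\<alpha> c x (H, a0) = (H #>\<^bsub>?G\<^esub> x, f (c,a0) x)" if "a0 \<in> {0..<int p}" "x \<in> carrier ?G" for c a0 x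
    using good[of x c] that HX[OF that(1)] generate_free_gen
    by (auto simp: good_def f_def prod_eq_iff)
  have fh: "f (c,a0) (h \<otimes>\<^bsub>?G\<^esub> x) = ((f (c,a0) h - a0) + f (c,a0) x) mod int p"
    if "a0 \<in> {0..<int p}" "h \<in> H" "x \<in> carrier ?G" for c a0 h x
  proof -
    have "\<alpha> c h (H, a0) = (H, f (c,a0) h)"
      using av[OF that(1), of h c] that coset_join2[of h H] H(1) by auto
    also have "\<dots> = sh (f (c,a0) h - a0) (H, a0)"
      using fr[OF that(1), of h c] that by (simp add: sh_def)
    finally have "\<alpha> c (h \<otimes>\<^bsub>?G\<^esub> x) (H, a0) = \<alpha> c x (sh (f (c,a0) h - a0) (H, a0))"
      using am[of h x "(H,a0)" c] that HX by auto
    also have "\<dots> = sh (f (c,a0) h - a0) (\<alpha> c x (H, a0))"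
      using good[of x c] that HX[OF that(1)] generate_free_gen by (auto simp: good_def)
    finally have "snd (\<alpha> c (h \<otimes>\<^bsub>?G\<^esub> x) (H, a0)) = (f (c,a0) x + (f (c,a0) h - a0)) mod int p"
      unfolding av[OF that(1,3)] by (simp add: sh_def)
    then show ?thesis by (simp add: f_def add.commute)
  qed
  define t :: "((bool \<Rightarrow> nat \<Rightarrow> nat) \<Rightarrow> nat \<Rightarrow> nat) set \<Rightarrow> _" where "t = coset_rep"
  have t: "t C \<in> carrier ?G" "H #>\<^bsub>?G\<^esub> t C = C" if "C \<in> R" for C
    using coset_rep[OF H(1)] that by (auto simp: t_def R_def)
  \<comment> \<open>The homomorphism attached to \<open>(c, a0)\<close>, paired with the values of
    its orbit function on the transversal. Together these determine \<open>f\<close> by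
    \<open>fh\<close>; then \<open>a0\<close> is the value at \<one>, and \<open>c\<close> is read
    off from \<open>fc\<close>. So \<open>p ^ (2 * card R + 1)\<close> pairs embed in
    \<open>mod_homs ?G H p \<times> V\<close>, and \<open>V\<close> has \<open>p ^ card R\<close>
    elements.\<close>
  define T where "T = (\<lambda>(c, a0). (restrict (\<lambda>h. (f (c,a0) h - a0) mod int p) H, restrict (\<lambda>C. f (c,a0) (t C)) R))"
  have fc: "f (c,a0) (t C \<otimes>\<^bsub>?G\<^esub> free_gen b) = (f (c,a0) (t C) + c (C, b)) mod int p"
    if "a0 \<in> {0..<int p}" "C \<in> R" for c a0 C b
  proof -
    have "\<alpha> c (t C \<otimes>\<^bsub>?G\<^esub> free_gen b) (H,a0) = \<tau> c b (C, f (c,a0) (t C))"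
      using am[OF t(1)[OF that(2)] free_gen_in HX[OF that(1)]] av[OF that(1) t(1)[OF that(2)], of c]
        t(2)[OF that(2)] ag[of "(C, f (c,a0) (t C))" c b] that fr[OF that(1) t(1)[OF that(2)]]
      by (auto simp: X_def)
    then show ?thesis by (simp add: f_def \<tau>_def)
  qed
  have inj: "inj_on T (D \<times> {0..<int p})"
  proof (rule inj_onI, clarify)
    fix c a c' a'
    assume c: "c \<in> D" "c' \<in> D" and a: "a \<in> {0..<int p}" "a' \<in> {0..<int p}" and eq: "T (c,a) = T (c',a')"
    have e1: "(f (c,a) h - a) mod int p = (f (c',a') h - a') mod int p" if "h \<in> H" for h
      using eq that by (auto simp: T_def dest!: fun_cong[of _ _ h])
    have e2: "f (c,a) (t C) = f (c',a') (t C)" if "C \<in> R" for C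
      using eq that by (auto simp: T_def dest!: fun_cong[of _ _ C])
    have ff: "f (c,a) x = f (c',a') x" if x: "x \<in> carrier ?G" for x
    proof -
      define C where "C = H #>\<^bsub>?G\<^esub> x"
      define h where "h = x \<otimes>\<^bsub>?G\<^esub> inv\<^bsub>?G\<^esub> (t C)"
      have C: "C \<in> R" using co[OF x] by (simp add: C_def)
      have h: "h \<in> H" using mult_inv_coset_rep[OF H(1) x] by (simp add: h_def C_def t_def)
      have x': "x = h \<otimes>\<^bsub>?G\<^esub> t C" using x t(1)[OF C] by (simp add: h_def m_assoc)
      have "((f (c,a) h - a) + f (c,a) (t C)) mod int p = ((f (c',a') h - a') + f (c',a') (t C)) mod int p"
        using e1[OF h] e2[OF C] by (metis mod_add_left_eq)
      then show ?thesis
        using fh[OF a(1) h t(1)[OF C], of c] fh[OF a(2) h t(1)[OF C], of c'] by (simp add: x')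
    qed
    have aa: "a = a'" using ff[OF one_closed] f1 a by simp
    have "c = c'"
      using c unfolding D_def
    proof (rule PiE_ext)
      fix w assume w: "w \<in> R \<times> (UNIV::bool set)"
      obtain C b where [simp]: "w = (C,b)" by (cases w)
      have C: "C \<in> R" using w by simp
      have "(f (c,a) (t C) + c (C,b)) mod int p = (f (c,a) (t C) + c' (C,b)) mod int p"
        using fc[OF a(1) C, of c b] fc[OF a(2) C, of c' b] ff[OF t(1)[OF C]]
          ff[of "t C \<otimes>\<^bsub>?G\<^esub> free_gen b"] t(1)[OF C] by simp
      then have "c (C,b) mod int p = c' (C,b) mod int p" by (simp add: mod_eq_dvd_iff)
      moreover have "c w \<in> {0..<int p}" "c' w \<in> {0..<int p}" using c w by (auto simp: D_def PiE_def Pi_def)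
      ultimately show "c w = c' w" by simp
    qed
    then show "c = c' \<and> a = a'" using aa by blast
  qed
  have "T ` (D \<times> {0..<int p}) \<subseteq> mod_homs ?G H p \<times> V"
  proof (rule image_subsetI)
    fix w assume "w \<in> D \<times> {0..<int p}"
    then obtain c a where w: "w = (c,a)" and a: "a \<in> {0..<int p}" by blast
    have "restrict (\<lambda>h. (f (c,a) h - a) mod int p) H \<in> mod_homs ?G H p"
      unfolding mod_homs_def
    proof (intro CollectI conjI ballI)
      fix x y assume xy: "x \<in> H" "y \<in> H"
      have "(f (c,a) (x \<otimes>\<^bsub>?G\<^esub> y) - a) mod int p = ((f (c,a) x - a) + (f (c,a) y - a)) mod int p"
        using fh[OF a xy(1), of y c] xy(2) by (simp add: mod_simps algebra_simps)
      then show "restrict (\<lambda>h. (f (c,a) h - a) mod int p) H (x \<otimes>\<^bsub>?G\<^esub> y) =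
        (restrict (\<lambda>h. (f (c,a) h - a) mod int p) H x + restrict (\<lambda>h. (f (c,a) h - a) mod int p) H y) mod int p"
        using xy by (simp add: mod_add_eq)
    qed (use p in auto)
    moreover have "restrict (\<lambda>C. f (c,a) (t C)) R \<in> V"
      using fr[OF a t(1)] by (auto simp: V_def)
    ultimately show "T w \<in> mod_homs ?G H p \<times> V" by (simp add: T_def w)
  qed
  moreover have "finite (mod_homs ?G H p \<times> V)" using fin finR by (auto simp: V_def intro: finite_PiE)
  ultimately have "card (D \<times> {0..<int p}) \<le> card (mod_homs ?G H p \<times> V)"
    by (rule card_inj_on_le[OF inj])
  moreover have "card D = p ^ (card R * 2)" using finR by (simp add: D_def card_PiE card_cartesian_product)
  moreover have "card V = p ^ card R" using finR by (simp add: V_def card_PiE)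
  ultimately have "p ^ (card R + 1) * p ^ card R \<le> card (mod_homs ?G H p) * p ^ card R"
    by (simp add: card_cartesian_product power_add mult_2_right mult_ac)
  then show ?thesis using p by (simp add: R_def)
qed

section \<open>Subgroups of finite index and prime power groups\<close>

lemma prime_power_of_unique_prime:
  fixes c :: nat
  assumes "c > 0" "\<And>r. prime r \<Longrightarrow> r dvd c \<Longrightarrow> r = q"
  shows "\<exists>n. c = q ^ n"
proof -
  have "prime_factors c \<subseteq> {q}" using assms(2) by auto
  then consider "prime_factors c = {}" | "prime_factors c = {q}" by blast
  then show ?thesis
  proof cases
    case 1
    then have "c = q ^ 0" using prime_factorization_nat[OF assms(1)] by simp
    then show ?thesis ..
  next
    case 2
    then have "c = q ^ multiplicity q c" using prime_factorization_nat[OF assms(1)] by simp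
    then show ?thesis ..
  qed
qed

context group
begin

section \<open>Powers of elements and subgroups of finite index\<close>

lemma mult_inv_cancel:
  assumes "x \<in> carrier G" "y \<in> carrier G"
  shows "x \<otimes> (inv x \<otimes> y) = y" "inv x \<otimes> (x \<otimes> y) = y"
  using assms by (simp_all flip: m_assoc)

text \<open>By Bezout, \<open>x\<close> is a product of powers of \<open>x [^] a\<close> and
  \<open>x [^] b\<close>.\<close>

lemma pow_coprime_mem:
  assumes H: "subgroup H G" and x: "x \<in> carrier G" "x [^] (a::nat) \<in> H" "x [^] (b::nat) \<in> H"
    and "coprime a b"
  shows "x \<in> H"
proof -
  have "coprime (int a) (int b)" using assms(5) by simp
  then obtain u v where uv: "u * int a + v * int b = 1"
    using bezout_int[of "int a" "int b"] by auto
  have "(x [^] a) [^] u \<in> H" "(x [^] b) [^] v \<in> H"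
    using subgroup_int_pow_closed[OF H] x by auto
  moreover have "(x [^] a) [^] u = x [^] (u * int a)" "(x [^] b) [^] v = x [^] (v * int b)"
    using int_pow_pow[OF x(1), of "int a" u] int_pow_pow[OF x(1), of "int b" v]
    by (simp_all add: int_pow_int mult.commute)
  ultimately have "x [^] (u * int a) \<otimes> x [^] (v * int b) \<in> H"
    using subgroup.m_closed[OF H] by metis
  then show ?thesis using uv x(1) by (simp flip: int_pow_mult)
qed

lemma rcos_pow_eq:
  assumes "subgroup H G" "x \<in> carrier G" "H #> x [^] i = H #> x [^] j" "i \<le> (j::nat)"
  shows "x [^] (j - i) \<in> H"
proof -
  have "x [^] j \<otimes> inv (x [^] i) \<in> H"
    using rcos_eq_iff[OF assms(1), of "x [^] j" "x [^] i"] assms by simp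
  moreover have "x [^] j = x [^] (j - i) \<otimes> x [^] i"
    using assms by (simp add: nat_pow_mult)
  ultimately show ?thesis using assms(2) by (simp add: m_assoc)
qed

text \<open>Pigeonhole on the cosets of \<open>x [^] 0\<close> up to \<open>x [^] k\<close>, where
  \<open>k\<close> is the index. The bound on \<open>a\<close> later restricts its prime
  factors.\<close>

lemma pow_mem_finite_index:
  assumes H: "subgroup H G" "finite (rcosets H)" and x: "x \<in> carrier G"
  obtains a :: nat where "0 < a" "a \<le> card (rcosets H)" "x [^] a \<in> H"
proof -
  let ?f = "\<lambda>i::nat. H #> x [^] i"
  let ?k = "card (rcosets H)"
  have "?f ` {0..?k} \<subseteq> rcosets H" using x by (auto simp: RCOSETS_def)
  then have "card (?f ` {0..?k}) < card {0..?k}"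
    using card_mono[OF H(2)] by (metis card_atLeastAtMost diff_zero less_Suc_eq_le)
  then have "\<not> inj_on ?f {0..?k}" by (rule pigeonhole)
  then obtain i j where "i \<le> ?k" "j \<le> ?k" "i \<noteq> j" "?f i = ?f j"
    by (auto simp: inj_on_def)
  then obtain i j where ij: "i < j" "j \<le> ?k" "?f i = ?f j"
    by (metis linorder_neqE_nat)
  then show thesis
    using that[of "j - i"] rcos_pow_eq[OF H(1) x, of i j] by auto
qed

text \<open>One half of the tower law for indices: a coset \<open>C\<close> of \<open>K\<close> and
  a coset \<open>D\<close> of \<open>H\<close> in \<open>K\<close> combine injectively to the coset
  \<open>D #> coset_rep C\<close> of \<open>H\<close>.\<close>

lemma card_rcosets_mult_le:
  assumes H: "subgroup H G" and K: "subgroup K G" and HK: "H \<subseteq> K" and fin: "finite (rcosets H)"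
  shows "finite (rcosets K)" "finite (rcosets\<^bsub>G\<lparr>carrier := K\<rparr>\<^esub> H)"
    "card (rcosets K) * card (rcosets\<^bsub>G\<lparr>carrier := K\<rparr>\<^esub> H) \<le> card (rcosets H)"
proof -
  let ?R = "rcosets\<^bsub>G\<lparr>carrier := K\<rparr>\<^esub> H"
  interpret H: subgroup H G by fact
  interpret K: subgroup K G by fact
  have RK: "?R = (\<lambda>x. H #> x) ` K" by (auto simp: RCOSETS_def)
  have RH: "rcosets H = (\<lambda>x. H #> x) ` carrier G" by (auto simp: RCOSETS_def)
  show finR: "finite ?R" unfolding RK using fin finite_subset[of _ "rcosets H"] RH K.subset by (metis image_mono)
  have coK: "K #> coset_rep C = K #> x" if "C = H #> x" "x \<in> carrier G" for C x
  proof -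
    have C: "C \<in> rcosets H" using that RH by auto
    from mult_inv_coset_rep[OF H that(2)] have "x \<otimes> inv (coset_rep C) \<in> K" using HK that by auto
    then show ?thesis using rcos_eq_iff[OF K that(2) coset_rep(1)[OF H C]] by simp
  qed
  have "rcosets K \<subseteq> (\<lambda>C. K #> coset_rep C) ` (rcosets H)"
    using coK RH by (fastforce simp: RCOSETS_def)
  then show finK: "finite (rcosets K)" using fin finite_surj by blast
  let ?f = "\<lambda>(C, D). D #> coset_rep C"
  have inj: "inj_on ?f ((rcosets K) \<times> ?R)"
  proof (rule inj_onI, clarsimp simp: RK)
    fix C C' x x'
    assume C: "C \<in> rcosets K" "C' \<in> rcosets K" and x: "x \<in> K" "x' \<in> K"
      and eq: "H #> x #> coset_rep C = H #> x' #> coset_rep C'"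
    note t = coset_rep[OF K C(1)] coset_rep[OF K C(2)]
    have "x \<otimes> coset_rep C \<otimes> inv (x' \<otimes> coset_rep C') \<in> H"
      using eq rcos_eq_iff[OF H, of "x \<otimes> coset_rep C" "x' \<otimes> coset_rep C'"] x t H.subset
      by (simp add: coset_mult_assoc)
    then have e: "x \<otimes> (coset_rep C \<otimes> inv (coset_rep C')) \<otimes> inv x' \<in> H"
      using x t by (simp add: m_assoc inv_mult_group)
    then have "inv x \<otimes> (x \<otimes> (coset_rep C \<otimes> inv (coset_rep C')) \<otimes> inv x') \<otimes> x' \<in> K"
      using HK x by (simp add: subsetD)
    then have "coset_rep C \<otimes> inv (coset_rep C') \<in> K"
      using x t K.subset by (simp add: m_assoc) (simp add: subsetD m_assoc[symmetric])
    then have CC: "C = C'" using rcos_eq_iff[OF K t(1) t(3)] t by simp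
    then have "x \<otimes> inv x' \<in> H" using e x t by simp
    then show "C = C' \<and> H #> x = H #> x'" using CC rcos_eq_iff[OF H] x by simp
  qed
  have "?f ` ((rcosets K) \<times> ?R) \<subseteq> rcosets H"
  proof clarify
    fix C D assume "C \<in> rcosets K" "D \<in> ?R"
    then show "D #> coset_rep C \<in> rcosets H"
      using coset_rep[OF K] H.subset by (auto simp: RK RH coset_mult_assoc)
  qed
  from card_inj_on_le[OF inj this fin]
  show "card (rcosets K) * card ?R \<le> card (rcosets H)" by (simp add: card_cartesian_product)
qed

text \<open>Schreier's lemma: \<open>Z\<close> consists of the Schreier generators for the
  transversal \<open>t\<close>, and along a word the representatives telescope.\<close>

lemma finite_index_imp_fin_gen:
  assumes H: "subgroup H G" "finite (rcosets H)" and Y: "finite Y" "generate G Y = carrier G"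
  obtains Z where "finite Z" "Z \<subseteq> H" "generate G Z = H"
proof -
  interpret H: subgroup H G by fact
  \<comment> \<open>The coset \<open>H\<close> itself needs the representative \<one>, so that
    \<open>key\<close> at \<open>C = H\<close> yields the element of \<open>H\<close> and not a
    conjugate of it.\<close>
  define t where "t C = (if C = H then \<one> else coset_rep C)" for C
  have t: "t C \<in> carrier G" "H #> t C = C" if "C \<in> rcosets H" for C
    using coset_rep[OF H(1) that] H.subset by (auto simp: t_def)
  have co: "C #> x \<in> rcosets H" if "C \<in> rcosets H" "x \<in> carrier G" for C x
    using that H.subset by (auto simp: RCOSETS_def coset_mult_assoc)
  have Yc: "Y \<subseteq> carrier G" unfolding Y(2)[symmetric] by (auto intro: generate.incl)
  define Z where "Z = (\<lambda>(C, y). t C \<otimes> y \<otimes> inv (t (C #> y))) ` ((rcosets H) \<times> Y)"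
  have ZH: "t C \<otimes> x \<otimes> inv (t (C #> x)) \<in> H" if "C \<in> rcosets H" "x \<in> carrier G" for C x
  proof -
    have "H #> (t C \<otimes> x) = C #> x"
      using coset_mult_assoc[OF H.subset t(1)[OF that(1)] that(2)] t(2)[OF that(1)] by simp
    then show ?thesis
      using rcos_eq_iff[OF H(1), of "t C \<otimes> x" "t (C #> x)"] t[OF that(1)] t[OF co[OF that]] that(2)
      by simp
  qed
  have Z: "Z \<subseteq> H" using ZH Yc by (auto simp: Z_def)
  then have Zc: "Z \<subseteq> carrier G" using H.subset by blast
  interpret U: subgroup "generate G Z" G using generate_is_subgroup[OF Zc] .
  have key: "\<forall>C\<in>rcosets H. t C \<otimes> x \<otimes> inv (t (C #> x)) \<in> generate G Z" if "x \<in> generate G Y" for x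
    using that
  proof (induction rule: generate.induct)
    case one
    have "C #> \<one> = C" if "C \<in> rcosets H" for C
      using that H.rcosets_carrier[OF is_group] by simp
    then show ?case using t by simp
  next
    case (incl h)
    then show ?case by (auto simp: Z_def intro!: generate.incl)
  next
    case (inv h)
    show ?case
    proof
      fix C assume C: "C \<in> rcosets H"
      have h: "h \<in> carrier G" using inv Yc by blast
      let ?D = "C #> inv h"
      have D: "?D \<in> rcosets H" using co[OF C] h by simp
      have "?D #> h = C"
        using coset_mult_assoc[of C "inv h" h] h C H.rcosets_carrier[OF is_group] by simp
      then have "t ?D \<otimes> h \<otimes> inv (t C) \<in> generate G Z"
        using D inv by (auto simp: Z_def intro!: generate.incl image_eqI[of _ _ "(?D, h)"])
      then have "inv (t ?D \<otimes> h \<otimes> inv (t C)) \<in> generate G Z" by (rule U.m_inv_closed)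
      then show "t C \<otimes> inv h \<otimes> inv (t ?D) \<in> generate G Z"
        using t[OF C] t[OF D] h by (simp add: inv_mult_group m_assoc)
    qed
  next
    case (eng h1 h2)
    show ?case
    proof
      fix C assume C: "C \<in> rcosets H"
      have h: "h1 \<in> carrier G" "h2 \<in> carrier G" using eng Y(2) by auto
      let ?D = "C #> h1"
      have D: "?D \<in> rcosets H" using co[OF C] h by simp
      have E: "?D #> h2 = C #> (h1 \<otimes> h2)"
        using coset_mult_assoc h C H.rcosets_carrier[OF is_group] by simp
      have E': "C #> (h1 \<otimes> h2) \<in> rcosets H" using co[OF C] h by simp
      have "(t C \<otimes> h1 \<otimes> inv (t ?D)) \<otimes> (t ?D \<otimes> h2 \<otimes> inv (t (C #> (h1 \<otimes> h2)))) \<in> generate G Z"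
        using eng.IH C D E by (metis U.m_closed)
      moreover have "(t C \<otimes> h1 \<otimes> inv (t ?D)) \<otimes> (t ?D \<otimes> h2 \<otimes> inv (t (C #> (h1 \<otimes> h2)))) =
        t C \<otimes> h1 \<otimes> (inv (t ?D) \<otimes> t ?D) \<otimes> h2 \<otimes> inv (t (C #> (h1 \<otimes> h2)))"
        using t[OF C] t[OF D] t[OF E'] h by (simp only: m_assoc m_closed inv_closed)
      ultimately show "t C \<otimes> (h1 \<otimes> h2) \<otimes> inv (t (C #> (h1 \<otimes> h2))) \<in> generate G Z"
        using t[OF C] t[OF D] t[OF E'] h by (simp add: m_assoc)
    qed
  qed
  have "H \<subseteq> generate G Z"
  proof
    fix h assume h: "h \<in> H"
    have HH: "H \<in> rcosets H" using H.subgroup_in_rcosets[OF is_group] .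
    have "H #> h = H" using h H(1) coset_join2 by simp
    then show "h \<in> generate G Z" using key[of h] HH h Y(2) by (auto simp: t_def)
  qed
  moreover have "generate G Z \<subseteq> H" using generate_subgroup_incl[OF Z H(1)] .
  moreover have "finite Z" using H(2) Y(1) by (simp add: Z_def)
  ultimately show thesis using that[of Z] Z by blast
qed

text \<open>The core is the kernel of the right action on the cosets of \<open>K\<close>.
  Representatives of distinct cosets of the core act by distinct maps \<open>F x\<close>, of which
  there are finitely many.\<close>

lemma normal_core:
  assumes K: "subgroup K G" "finite (rcosets K)"
  defines "C \<equiv> {x \<in> carrier G. \<forall>y\<in>carrier G. y \<otimes> x \<otimes> inv y \<in> K}"
  shows "C \<lhd> G" "finite (rcosets C)" "C \<subseteq> K"
proof -
  interpret K: subgroup K G by fact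
  show CK: "C \<subseteq> K"
  proof
    fix x assume "x \<in> C"
    then show "x \<in> K" unfolding C_def by (auto dest!: bspec[of _ _ \<one>])
  qed
  have sub: "subgroup C G"
  proof (rule subgroupI)
    show "C \<subseteq> carrier G" by (auto simp: C_def)
    have "\<one> \<in> C" by (simp add: C_def)
    then show "C \<noteq> {}" by blast
  next
    fix a assume a: "a \<in> C"
    have "y \<otimes> inv a \<otimes> inv y \<in> K" if y: "y \<in> carrier G" for y
    proof -
      have "inv (y \<otimes> a \<otimes> inv y) \<in> K" using a y by (auto simp: C_def)
      then show ?thesis using a y by (simp add: inv_mult_group m_assoc C_def)
    qed
    then show "inv a \<in> C" using a by (auto simp: C_def)
  next
    fix a b assume ab: "a \<in> C" "b \<in> C"
    have "y \<otimes> (a \<otimes> b) \<otimes> inv y \<in> K" if y: "y \<in> carrier G" for y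
    proof -
      have c: "a \<in> carrier G" "b \<in> carrier G" using ab by (auto simp: C_def)
      have "(y \<otimes> a \<otimes> inv y) \<otimes> (y \<otimes> b \<otimes> inv y) \<in> K" using ab y by (auto simp: C_def)
      moreover have "(y \<otimes> a \<otimes> inv y) \<otimes> (y \<otimes> b \<otimes> inv y) = y \<otimes> a \<otimes> (inv y \<otimes> y) \<otimes> b \<otimes> inv y"
        using c y by (simp only: m_assoc m_closed inv_closed)
      ultimately show ?thesis using c y by (simp add: m_assoc)
    qed
    then show "a \<otimes> b \<in> C" using ab by (auto simp: C_def)
  qed
  show "C \<lhd> G"
    unfolding normal_inv_iff
  proof (intro conjI ballI sub)
    fix x h assume x: "x \<in> carrier G" and h: "h \<in> C"
    have hc: "h \<in> carrier G" using h by (simp add: C_def)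
    have "y \<otimes> (x \<otimes> h \<otimes> inv x) \<otimes> inv y \<in> K" if y: "y \<in> carrier G" for y
    proof -
      have "(y \<otimes> x) \<otimes> h \<otimes> inv (y \<otimes> x) \<in> K" using h x y unfolding C_def by blast
      then show ?thesis using x y hc by (simp add: inv_mult_group m_assoc)
    qed
    then show "x \<otimes> h \<otimes> inv x \<in> C" using x hc by (simp add: C_def)
  qed
  define F where "F x = restrict (\<lambda>D. D #> x) (rcosets K)" for x
  have co: "D #> x \<in> rcosets K" if "D \<in> rcosets K" "x \<in> carrier G" for D x
    using that K.subset by (auto simp: RCOSETS_def coset_mult_assoc)
  have "inj_on (\<lambda>D. F (coset_rep D)) (rcosets C)"
  proof (rule inj_onI)
    fix D D' assume D: "D \<in> rcosets C" "D' \<in> rcosets C" and eq: "F (coset_rep D) = F (coset_rep D')"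
    note t = coset_rep[OF sub D(1)] coset_rep[OF sub D(2)]
    have "y \<otimes> (coset_rep D \<otimes> inv (coset_rep D')) \<otimes> inv y \<in> K" if y: "y \<in> carrier G" for y
    proof -
      have "K #> y \<in> rcosets K" using y by (auto simp: RCOSETS_def)
      then have "K #> y #> coset_rep D = K #> y #> coset_rep D'"
        using fun_cong[OF eq, of "K #> y"] by (simp add: F_def)
      then have "K #> (y \<otimes> coset_rep D) = K #> (y \<otimes> coset_rep D')"
        using y t K.subset by (simp add: coset_mult_assoc)
      then have "y \<otimes> coset_rep D \<otimes> inv (y \<otimes> coset_rep D') \<in> K"
        using rcos_eq_iff[OF K(1), of "y \<otimes> coset_rep D" "y \<otimes> coset_rep D'"] y t by simp
      then show ?thesis using y t by (simp add: inv_mult_group m_assoc)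
    qed
    then have "coset_rep D \<otimes> inv (coset_rep D') \<in> C" using t by (simp add: C_def)
    then show "D = D'" using rcos_eq_iff[OF sub t(1) t(3)] t by simp
  qed
  moreover have "(\<lambda>D. F (coset_rep D)) ` (rcosets C) \<subseteq> rcosets K \<rightarrow>\<^sub>E rcosets K"
    using co coset_rep(1)[OF sub] by (auto simp: F_def)
  moreover have "finite (rcosets K \<rightarrow>\<^sub>E rcosets K)" using K(2) by (auto intro: finite_PiE)
  ultimately show "finite (rcosets C)" by (meson finite_imageD finite_subset)
qed

text \<open>Sylow's theorem with exponent 1 gives, for each prime divisor \<open>r\<close> of the
  group order, a nontrivial element killed by \<open>r\<close>. Its order also divides a power of
  \<open>q\<close>, which forces \<open>r = q\<close>.\<close>

lemma order_prime_power:
  assumes fin: "finite (carrier G)" and q: "prime q"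
    and tors: "\<And>x. x \<in> carrier G \<Longrightarrow> \<exists>n. x [^] (q ^ n) = \<one>"
  shows "\<exists>n. order G = q ^ n"
proof -
  have o: "order G > 0" using fin order_gt_0_iff_finite by blast
  have "r = q" if r: "prime r" "r dvd order G" for r
  proof -
    obtain m where "order G = r ^ 1 * m" using r by auto
    then obtain H where H: "subgroup H G" "card H = r ^ 1"
      using sylow_thm[OF r(1) is_group _ fin] by blast
    have "card H > 1" using H(2) prime_gt_1_nat[OF r(1)] by simp
    then obtain x where x: "x \<in> H" "x \<noteq> \<one>"
      by (metis card_le_Suc0_iff_eq card.infinite less_numeral_extra(1) linorder_not_le One_nat_def not_less_zero)
    have xc: "x \<in> carrier G" using H x subgroup.mem_carrier by metis
    interpret H: group "G\<lparr>carrier := H\<rparr>" using subgroup.subgroup_is_group[OF H(1) is_group] .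
    have "x [^]\<^bsub>G\<lparr>carrier := H\<rparr>\<^esub> order (G\<lparr>carrier := H\<rparr>) = \<one>"
      using H.pow_order_eq_1[of x] x by simp
    then have "x [^] r = \<one>" using H(2) by (simp add: order_def flip: nat_pow_consistent)
    then have d: "ord x dvd r" using pow_eq_id[OF xc] by simp
    obtain n where "x [^] (q ^ n) = \<one>" using tors[OF xc] by blast
    then have "ord x dvd q ^ n" using pow_eq_id[OF xc] by simp
    moreover have "ord x \<noteq> 1" using x ord_eq_1[OF xc] by simp
    ultimately have "r dvd q ^ n" using d r(1) by (metis prime_nat_iff)
    then show "r = q" using r(1) q by (metis prime_dvd_power primes_dvd_imp_eq)
  qed
  then show ?thesis using prime_power_of_unique_prime[OF o] by blast
qed

text \<open>A subgroup \<open>H\<close> of order \<open>q ^ (n - 1)\<close> exists by Sylow, and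
  having index \<open>q\<close> it turns out to be normal. The quotient is cyclic of order
  \<open>q\<close>, and the discrete logarithm in it is the homomorphism sought.\<close>

lemma prime_power_group_hom:
  assumes fin: "finite (carrier G)" and q: "prime q" and nontriv: "carrier G \<noteq> {\<one>}"
    and tors: "\<And>x. x \<in> carrier G \<Longrightarrow> \<exists>n. x [^] (q ^ n) = \<one>"
  shows "\<exists>\<psi>\<in>mod_homs G (carrier G) q. \<exists>x\<in>carrier G. \<psi> x \<noteq> 0"
proof -
  obtain n where n: "order G = q ^ n" using order_prime_power[OF fin q tors] by blast
  have "n \<noteq> 0" using n nontriv order_one_triv_iff by (metis power_0)
  then have n': "order G = q ^ (n - 1) * q" using n by (metis power_minus_mult not_gr_zero)
  then obtain H where H: "subgroup H G" "card H = q ^ (n - 1)"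
    using sylow_thm[OF q is_group _ fin] by blast
  have q1: "q > 1" using prime_gt_1_nat[OF q] .
  have idx: "card (rcosets H) = q"
    using lagrange[OF H(1)] H(2) n' q1 by simp
  have finR: "finite (rcosets H)" using idx q1 by (metis card.infinite not_less_zero)
  interpret H: subgroup H G by fact
  \<comment> \<open>Exponents strictly between 0 and \<open>q\<close> are coprime to the order of
    \<open>x\<close>, which divides a power of \<open>q\<close>.\<close>
  have root: "x \<in> H" if x: "x \<in> carrier G" "x [^] a \<in> H" "0 < a" "a < q" for x and a :: nat
  proof -
    obtain m where "x [^] (q ^ m) = \<one>" using tors[OF x(1)] by blast
    moreover have "coprime a q" using x q by (meson coprime_commute nat_dvd_not_less prime_imp_coprime)
    ultimately show ?thesis
      using pow_coprime_mem[OF H(1) x(1,2), of "q ^ m"] by simp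
  qed
  \<comment> \<open>Normality. For \<open>x\<close> outside \<open>H\<close>, the \<open>q\<close>
    cosets of the elements \<open>x \<otimes> h [^] i\<close> all differ from \<open>H\<close>,
    which leaves only \<open>q - 1\<close> cosets. Two of them coincide, so the conjugate of some
    \<open>h [^] (j - i)\<close> lies in \<open>H\<close>, and \<open>root\<close> removes the
    exponent.\<close>
  have "x \<otimes> h \<otimes> inv x \<in> H" if x: "x \<in> carrier G" and h: "h \<in> H" for x h
  proof (cases "x \<in> H")
    case True
    then show ?thesis using h by simp
  next
    case False
    have hc: "h \<in> carrier G" using h by simp
    let ?f = "\<lambda>i::nat. H #> (x \<otimes> h [^] i)"
    have hp: "h [^] i \<in> H" for i :: nat using subgroup_int_pow_closed[OF H(1) h, of "int i"] by (simp add: int_pow_int)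
    have "?f i \<noteq> H" for i
    proof
      assume "?f i = H"
      then have "x \<otimes> h [^] i \<in> H" using rcos_self[OF _ H(1), of "x \<otimes> h [^] i"] x hc by simp
      then have "x \<otimes> h [^] i \<otimes> inv (h [^] i) \<in> H" using hp by blast
      then show False using False x hc by (simp add: m_assoc)
    qed
    then have "?f ` {0..<q} \<subseteq> rcosets H - {H}" using x hc by (auto intro!: rcosetsI H.subset)
    then have "card (?f ` {0..<q}) \<le> card (rcosets H - {H})"
      by (intro card_mono) (use finR in simp)
    also have "\<dots> < card {0..<q}"
      using idx q1 finR H.subgroup_in_rcosets[OF is_group] by simp
    finally have "\<not> inj_on ?f {0..<q}" by (rule pigeonhole)
    then obtain i j where "i < q" "j < q" "i \<noteq> j" "?f i = ?f j" by (auto simp: inj_on_def)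
    then obtain i j where ij: "i < j" "j < q" "?f i = ?f j" by (metis linorder_neqE_nat)
    have "x \<otimes> h [^] j \<otimes> inv (x \<otimes> h [^] i) \<in> H"
      using rcos_eq_iff[OF H(1), of "x \<otimes> h [^] j" "x \<otimes> h [^] i"] ij(3) x hc by simp
    moreover have "h [^] j = h [^] (j - i) \<otimes> h [^] i" using ij hc by (simp add: nat_pow_mult)
    ultimately have m: "x \<otimes> h [^] (j - i) \<otimes> inv x \<in> H"
      using x hc by (simp add: inv_mult_group m_assoc mult_inv_cancel)
    have "(x \<otimes> h \<otimes> inv x) [^] k = x \<otimes> h [^] k \<otimes> inv x" for k :: nat
    proof (induction k)
      case (Suc k)
      have "(x \<otimes> h [^] k \<otimes> inv x) \<otimes> (x \<otimes> h \<otimes> inv x) = x \<otimes> h [^] k \<otimes> (inv x \<otimes> x) \<otimes> h \<otimes> inv x"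
        using x hc by (simp only: m_assoc m_closed inv_closed nat_pow_closed)
      then show ?case using Suc x hc by (simp add: m_assoc)
    qed (use x in simp)
    then show ?thesis using root[of "x \<otimes> h \<otimes> inv x" "j - i"] m ij x hc by auto
  qed
  then have N: "H \<lhd> G" using H(1) normal_inv_iff by blast
  interpret N: normal H G by fact
  have "H \<noteq> carrier G" using idx q1 lagrange[OF H(1)] fin carrier_not_empty by (auto simp: order_def)
  then obtain t where t: "t \<in> carrier G" "t \<notin> H" using H.subset by blast
  let ?f = "\<lambda>i::nat. H #> t [^] i"
  have inj: "inj_on ?f {0..<q}"
  proof (rule linorder_inj_onI)
    fix i j assume ij: "i < j" "i \<in> {0..<q}" "j \<in> {0..<q}"
    then show "?f i \<noteq> ?f j"
      using rcos_pow_eq[OF H(1) t(1), of i j] root[OF t(1), of "j - i"] t(2)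
      by (auto simp: less_imp_diff_less)
  qed auto
  have "?f ` {0..<q} \<subseteq> rcosets H" using t by (auto simp: RCOSETS_def)
  moreover have "card (?f ` {0..<q}) = card (rcosets H)" using card_image[OF inj] idx by simp
  ultimately have surj: "?f ` {0..<q} = rcosets H" using card_subset_eq[OF finR] by blast
  interpret Q: group "G Mod H" using N.factorgroup_is_group .
  have tq: "H #> t [^] q = H"
  proof -
    have "(H #> t) [^]\<^bsub>G Mod H\<^esub> q = H"
      using Q.pow_order_eq_1[of "H #> t"] t idx by (auto simp: order_def FactGroup_def RCOSETS_def)
    then show ?thesis using N.FactGroup_pow[OF t(1)] by simp
  qed
  have tm: "?f k = ?f (k mod q)" for k
  proof -
    have "t [^] q \<in> H" using tq rcos_self[OF _ H(1), of "t [^] q"] t(1) by simp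
    then have a: "(t [^] q) [^] (k div q) \<in> H"
      using subgroup_int_pow_closed[OF H(1), of "t [^] q" "int (k div q)"] by (simp only: int_pow_int)
    have "t [^] k = (t [^] q) [^] (k div q) \<otimes> t [^] (k mod q)"
      using t(1) by (simp add: nat_pow_pow nat_pow_mult)
    then show ?thesis using rcos_mult_left[OF H(1) a] t(1) by simp
  qed
  \<comment> \<open>The discrete logarithm to the base \<open>H #> t\<close> in the quotient by
    \<open>H\<close>.\<close>
  define e where "e x = (THE i. i \<in> {0..<q} \<and> ?f i = H #> x)" for x
  have e: "e x < q \<and> ?f (e x) = H #> x" if "x \<in> carrier G" for x
  proof -
    have "H #> x \<in> ?f ` {0..<q}" using surj that by (auto simp: RCOSETS_def)
    then have "\<exists>!i. i \<in> {0..<q} \<and> ?f i = H #> x" using inj by (auto simp: inj_on_def)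
    from theI'[OF this] show ?thesis by (simp add: e_def)
  qed
  define \<psi> where "\<psi> = restrict (\<lambda>x. int (e x)) (carrier G)"
  have "\<psi> \<in> mod_homs G (carrier G) q"
    unfolding mod_homs_def
  proof (intro CollectI conjI ballI)
    show "\<psi> \<in> carrier G \<rightarrow>\<^sub>E {0..<int q}" using e by (auto simp: \<psi>_def)
    fix x y assume xy: "x \<in> carrier G" "y \<in> carrier G"
    have "?f (e (x \<otimes> y)) = (H #> x) <#> (H #> y)" using e xy N.rcos_sum by simp
    also have "\<dots> = ?f (e x) <#> ?f (e y)" using e xy by simp
    also have "\<dots> = ?f (e x + e y)" using t N.rcos_sum by (simp add: nat_pow_mult)
    also have "\<dots> = ?f ((e x + e y) mod q)" by (rule tm)
    finally have "e (x \<otimes> y) = (e x + e y) mod q"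
      by (rule inj_onD[OF inj]) (use e[of "x \<otimes> y"] xy q1 in auto)
    then show "\<psi> (x \<otimes> y) = (\<psi> x + \<psi> y) mod int q" using xy by (simp add: \<psi>_def zmod_int)
  qed
  moreover have "\<psi> t \<noteq> 0"
  proof
    assume "\<psi> t = 0"
    then have "H #> t = H" using e[OF t(1)] t(1) H.subset by (simp add: \<psi>_def)
    then show False using t rcos_self[OF _ H(1)] by blast
  qed
  ultimately show ?thesis using t(1) by blast
qed

text \<open>The bound of \<open>card_mod_homs_le\<close> with \<open>U\<close> empty limits the size
  of every set of homomorphisms. Finiteness has to be known because an infinite set has
  \<open>card\<close> 0, which would void lower bounds.\<close>

lemma finite_mod_homs:
  assumes H: "subgroup H G" "finite (rcosets H)" and p: "p > 0"
    and Y: "finite Y" "Y \<subseteq> carrier G" "generate G Y = carrier G"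
  shows "finite (mod_homs G H p)"
proof (rule ccontr)
  assume "infinite (mod_homs G H p)"
  then obtain \<Phi> where \<Phi>: "\<Phi> \<subseteq> mod_homs G H p"
    "card \<Phi> = p ^ (card (rcosets H) * card Y + 1) + 1"
    using infinite_arbitrarily_large by blast
  have "card \<Phi> * p ^ card (rcosets H) \<le> p ^ (card (rcosets H) * card Y + 1)"
    using Y \<Phi> by (intro card_mod_homs_le[OF H p, where U = "{}"]) auto
  moreover have "card \<Phi> * 1 \<le> card \<Phi> * p ^ card (rcosets H)"
    using p by (intro mult_le_mono2) simp
  ultimately show False using \<Phi>(2) by simp
qed

end

section \<open>The series\<close>

definition coset_ord :: "('a, 'b) monoid_scheme \<Rightarrow> 'a set \<Rightarrow> 'a \<Rightarrow> nat" where
  "coset_ord G L x = group.ord (G Mod L) (L #>\<^bsub>G\<^esub> x)"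

context group
begin

lemma pow_mem_iff_coset_ord:
  assumes "L \<lhd> G" "x \<in> carrier G"
  shows "x [^] (n::nat) \<in> L \<longleftrightarrow> coset_ord G L x dvd n"
proof -
  interpret L: normal L G by fact
  interpret Q: group "G Mod L" using L.factorgroup_is_group .
  have c: "L #> x \<in> carrier (G Mod L)" using assms by (auto simp: carrier_FactGroup)
  have "x [^] n \<in> L \<longleftrightarrow> L #> x [^] n = L"
    using coset_join2[OF _ L.subgroup_axioms] rcos_self[OF _ L.subgroup_axioms] assms(2)
    by (metis nat_pow_closed)
  also have "\<dots> \<longleftrightarrow> coset_ord G L x dvd n"
    using Q.pow_eq_id[OF c, of n] L.FactGroup_pow[OF assms(2), of n] by (simp add: coset_ord_def)
  finally show ?thesis .
qed

lemma coset_ord_pos: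
  assumes "L \<lhd> G" "finite (rcosets L)" "x \<in> carrier G"
  shows "coset_ord G L x > 0" "coset_ord G L x \<le> card (rcosets L)"
proof -
  obtain a :: nat where a: "0 < a" "a \<le> card (rcosets L)" "x [^] a \<in> L"
    using pow_mem_finite_index[OF normal_imp_subgroup[OF assms(1)] assms(2,3)] by blast
  then have "coset_ord G L x dvd a" using pow_mem_iff_coset_ord[OF assms(1,3)] by blast
  then show "coset_ord G L x > 0" "coset_ord G L x \<le> card (rcosets L)"
    using a by (auto intro: Nat.gr0I dest: dvd_imp_le)
qed

lemma pow_coset_ord_mem:
  assumes "L \<lhd> G" "x \<in> carrier G"
  shows "x [^] coset_ord G L x \<in> L"
  by (simp add: pow_mem_iff_coset_ord[OF assms])

lemma coset_ord_dvd:
  assumes "L \<lhd> G" "N \<lhd> G" "N \<subseteq> L" "x \<in> carrier G"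
  shows "coset_ord G L x dvd coset_ord G N x"
  by (rule iffD1[OF pow_mem_iff_coset_ord[OF assms(1,4)]
        subsetD[OF assms(3) pow_coset_ord_mem[OF assms(2,4)]]])

text \<open>The image of \<open>inv z \<otimes> w \<otimes> z\<close> under a homomorphism from \<open>L\<close> to an abelian group
  depends only on the coset of \<open>z\<close> modulo \<open>\<langle>x\<rangle> L\<close>, because \<open>x\<close> commutes with its power \<open>w\<close>.\<close>

lemma conjugate_representatives:
  assumes L: "L \<lhd> G" "finite (rcosets L)" and x: "x \<in> carrier G"
  defines "w \<equiv> x [^] coset_ord G L x"
  obtains Y where "finite Y" "Y \<subseteq> L" "card Y * coset_ord G L x \<le> card (rcosets L)"
    "\<And>\<phi> q z. \<phi> \<in> mod_homs G L q \<Longrightarrow> z \<in> carrier G \<Longrightarrow>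
       \<forall>y\<in>Y. \<phi> y = 0 \<Longrightarrow> \<phi> (inv z \<otimes> w \<otimes> z) = 0"
proof -
  interpret L: normal L G by fact
  interpret Q: group "G Mod L" using L.factorgroup_is_group .
  let ?P = "G Mod L" and ?a = "L #> x"
  have wL: "w \<in> L" using pow_coset_ord_mem[OF L(1) x] by (simp add: w_def)
  have wc: "w \<in> carrier G" using wL by simp
  have a: "?a \<in> carrier ?P" using x by (auto simp: carrier_FactGroup)
  \<comment> \<open>The cyclic subgroup generated by the image of \<open>x\<close> has
    \<open>coset_ord G L x\<close> elements. By Lagrange, one conjugate of \<open>w\<close> for each
    of its cosets is as many as the bound on \<open>card Y\<close> permits.\<close>
  define B where "B = generate ?P {?a}"
  have B: "subgroup B ?P" unfolding B_def by (rule Q.generate_is_subgroup) (use a in simp)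
  have PR: "carrier ?P = rcosets L" by (simp add: FactGroup_def)
  have finP: "finite (carrier ?P)" using L(2) PR by simp
  have n0: "Q.ord ?a \<noteq> 0" using coset_ord_pos(1)[OF L x] by (simp add: coset_ord_def)
  have Bn: "card B = coset_ord G L x"
    using Q.generate_pow_card[OF a] by (simp add: B_def coset_ord_def)
  have BP: "B = {?a [^]\<^bsub>?P\<^esub> k | k. k \<in> (UNIV :: nat set)}"
    unfolding B_def by (rule Q.generate_pow_nat[OF a n0])
  \<comment> \<open>A coset of \<open>B\<close> is a set of cosets of \<open>L\<close>, so two
    choices are needed to reach an element of \<open>G\<close>.\<close>
  define r where "r D = coset_rep (coset_rep D)" for D :: "'a set set"
  define Y where "Y = (\<lambda>D. inv (r D) \<otimes> w \<otimes> r D) ` (rcosets\<^bsub>?P\<^esub> B)"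
  have fR: "finite (rcosets\<^bsub>?P\<^esub> B)" using finP by (simp add: RCOSETS_def)
  have repP: "coset_rep D \<in> rcosets L" if "D \<in> rcosets\<^bsub>?P\<^esub> B" for D
    using Q.coset_rep(1)[OF B that] PR by simp
  have rc: "r D \<in> carrier G" "L #> r D = coset_rep D" if "D \<in> rcosets\<^bsub>?P\<^esub> B" for D
    using coset_rep[OF L.subgroup_axioms repP[OF that]] by (simp_all add: r_def)
  have YL: "Y \<subseteq> L" using rc(1) L.inv_op_closed1[OF _ wL] by (auto simp: Y_def)
  have "card Y \<le> card (rcosets\<^bsub>?P\<^esub> B)" unfolding Y_def by (rule card_image_le[OF fR])
  then have "card Y * coset_ord G L x \<le> card (rcosets\<^bsub>?P\<^esub> B) * card B" by (simp add: Bn)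
  also have "\<dots> = card (rcosets L)" using Q.lagrange[OF B] PR by (simp add: order_def)
  finally have card: "card Y * coset_ord G L x \<le> card (rcosets L)" .
  have "\<phi> (inv z \<otimes> w \<otimes> z) = 0"
    if \<phi>: "\<phi> \<in> mod_homs G L q" and z: "z \<in> carrier G" and 0: "\<forall>y\<in>Y. \<phi> y = 0" for \<phi> q z
  proof -
    have zP: "L #> z \<in> carrier ?P" using z by (auto simp: carrier_FactGroup)
    define D where "D = B #>\<^bsub>?P\<^esub> (L #> z)"
    have D: "D \<in> rcosets\<^bsub>?P\<^esub> B" using zP by (auto simp: D_def RCOSETS_def)
    have "L #> z \<in> D" using Q.rcos_self[OF zP B] by (simp add: D_def)
    moreover have "D = B #>\<^bsub>?P\<^esub> (L #> r D)" using Q.coset_rep(2)[OF B D] rc(2)[OF D] by simp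
    ultimately obtain b where b: "b \<in> B" "L #> z = b <#> (L #> r D)"
      by (auto simp: r_coset_def[of "?P"])
    obtain k :: nat where k: "b = ?a [^]\<^bsub>?P\<^esub> k" using b(1) BP by blast
    have "L #> z = L #> (x [^] k \<otimes> r D)"
      using b(2) L.FactGroup_pow[OF x, of k] L.rcos_sum x rc(1)[OF D] by (simp add: k)
    then have "inv (x [^] k \<otimes> r D) \<otimes> z \<in> L"
      using rcos_eq_iff[OF L.subgroup_axioms, of z "x [^] k \<otimes> r D"] x rc(1)[OF D] z
        L.inv_op_closed1[of "x [^] k \<otimes> r D" "z \<otimes> inv (x [^] k \<otimes> r D)"]
      by (simp add: m_assoc)
    then obtain l where l: "l \<in> L" "l = inv (x [^] k \<otimes> r D) \<otimes> z" by blast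
    have zl: "z = x [^] k \<otimes> r D \<otimes> l"
      using l(2) x rc(1)[OF D] z by (simp add: mult_inv_cancel)
    have xw: "w \<otimes> x [^] k = x [^] k \<otimes> w" using x by (simp add: w_def nat_pow_mult add.commute)
    have "inv z \<otimes> w \<otimes> z = inv l \<otimes> (inv (r D) \<otimes> inv (x [^] k) \<otimes> (w \<otimes> x [^] k) \<otimes> r D) \<otimes> l"
      using x rc(1)[OF D] l(1) wc by (simp add: zl inv_mult_group m_assoc)
    also have "\<dots> = inv l \<otimes> (inv (r D) \<otimes> w \<otimes> r D) \<otimes> l"
      unfolding xw using x rc(1)[OF D] l(1) wc by (simp add: m_assoc mult_inv_cancel)
    finally have "\<phi> (inv z \<otimes> w \<otimes> z) = \<phi> (inv (r D) \<otimes> w \<otimes> r D)"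
      using mod_homs_conj[OF L.subgroup_axioms \<phi> l(1)] YL D by (auto simp: Y_def)
    then show ?thesis using 0 D by (auto simp: Y_def)
  qed
  then show thesis using that[of Y] YL card fR by (simp add: Y_def)
qed

end

lemma sum_inverse_powers_le: "(\<Sum>k<n. 1 / 2 ^ (k + 2)) \<le> (1 / 2 :: real)"
proof -
  have "(\<Sum>k<n. 1 / 2 ^ (k + 2)) = (1 / 2 :: real) - 1 / 2 ^ (n + 1)"
    by (induction n) (simp_all add: field_simps)
  then show ?thesis by simp
qed

text \<open>The properties of the free group of rank two on which the construction rests. In that
  group a subgroup of index \<open>m\<close> is free of rank \<open>m + 1\<close>, whence the
  exponent in \<open>abundant\<close>.\<close>

locale abundant_group = group G for G (structure) +
  fixes X
  assumes finite_gens: "finite X" and gens_closed: "X \<subseteq> carrier G"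
    and gens: "generate G X = carrier G"
    and abundant: "\<And>H p. subgroup H G \<Longrightarrow> finite (rcosets H) \<Longrightarrow> prime p \<Longrightarrow>
       p ^ (card (rcosets H) + 1) \<le> card (mod_homs G H p)"

locale torsion_series = abundant_group +
  fixes g :: "nat \<Rightarrow> 'a" and p :: "nat \<Rightarrow> nat" and A :: "nat set"
  assumes enum: "range g = carrier G" and prime_p: "\<And>i. i \<in> A \<Longrightarrow> prime (p i)"
    and infinite_A: "infinite A"
begin

text \<open>The powers \<open>g k ^ n\<close> with \<open>n\<close> the order of \<open>g k\<close> modulo \<open>L\<close> are imposed as relations once \<open>n\<close>
  exceeds \<open>2 ^ (k + 2)\<close>. In a normal subgroup \<open>L\<close> of index \<open>m\<close> this amounts to at most \<open>m / n\<close>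
  relations for each \<open>k\<close>, hence to at most \<open>m / 2\<close> relations in total.\<close>

definition relators :: "'a set \<Rightarrow> 'a set" where
  "relators L = {inv z \<otimes> (g k [^] coset_ord G L (g k)) \<otimes> z | z k.
     z \<in> carrier G \<and> 2 ^ (k + 2) < coset_ord G L (g k)}"

definition relator_homs :: "'a set \<Rightarrow> nat \<Rightarrow> ('a \<Rightarrow> int) set" where
  "relator_homs L q = {\<phi> \<in> mod_homs G L q. \<forall>s\<in>relators L. \<phi> s = 0}"

text \<open>For prime \<open>q\<close>, the quotient of \<open>L\<close> by this subgroup is the
  largest elementary abelian \<open>q\<close>-quotient of \<open>L\<close> in which the relators
  die. The description by homomorphisms suits the counting.\<close>

definition next_term :: "'a set \<Rightarrow> nat \<Rightarrow> 'a set" where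
  "next_term L q = {x \<in> L. \<forall>\<phi>\<in>relator_homs L q. \<phi> x = 0}"

text \<open>Term \<open>Suc i\<close> is formed with \<open>p (Suc i)\<close>, the indexing of
  \<open>graded_series\<close>; at indices outside \<open>A\<close> the term is repeated.\<close>

primrec series :: "nat \<Rightarrow> 'a set" where
  "series 0 = carrier G"
| "series (Suc i) = (if Suc i \<in> A then next_term (series i) (p (Suc i)) else series i)"

definition residual :: "'a set" where
  "residual = (\<Inter>i. series i)"

section \<open>Relators and a single step of the series\<close>

lemma g_closed [simp]: "g k \<in> carrier G"
  using enum by blast

lemma relators_subset:
  assumes "L \<lhd> G"
  shows "relators L \<subseteq> L"
  using normal.inv_op_closed1[OF assms _ pow_coset_ord_mem[OF assms g_closed]]
  by (auto simp: relators_def)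

lemma relators_conj:
  assumes "L \<lhd> G" "s \<in> relators L" "y \<in> carrier G"
  shows "y \<otimes> s \<otimes> inv y \<in> relators L"
proof -
  obtain z k where s: "s = inv z \<otimes> (g k [^] coset_ord G L (g k)) \<otimes> z" "z \<in> carrier G"
    "2 ^ (k + 2) < coset_ord G L (g k)"
    using assms(2) by (auto simp: relators_def)
  have "y \<otimes> s \<otimes> inv y = inv (z \<otimes> inv y) \<otimes> (g k [^] coset_ord G L (g k)) \<otimes> (z \<otimes> inv y)"
    using s assms(3) by (simp add: m_assoc inv_mult_group)
  then show ?thesis using s assms(3) unfolding relators_def by blast
qed

text \<open>With \<open>m\<close> the index of \<open>L\<close>, the first conclusion says that
  \<open>j\<close> is at least \<open>m / 2 + 1\<close>. Vanishing on all relators follows from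
  vanishing on a set \<open>U\<close> of at most \<open>m / 2\<close> elements, and the
  \<open>m + 1\<close> supplied by \<open>abundant\<close> drops by at most
  \<open>card U\<close>.\<close>

lemma card_relator_homs:
  assumes L: "L \<lhd> G" "finite (rcosets L)" and q: "prime q"
  obtains j where "card (rcosets L) + 2 \<le> 2 * j" "q ^ j \<le> card (relator_homs L q)"
proof -
  let ?m = "card (rcosets L)"
  \<comment> \<open>Only finitely many \<open>k\<close> contribute relators, since orders modulo
    \<open>L\<close> do not exceed the index of \<open>L\<close>.\<close>
  define I where "I = {k. 2 ^ (k + 2) < coset_ord G L (g k)}"
  have kI: "k < ?m" if "k \<in> I" for k
  proof -
    have "k < 2 ^ (k + 2)" using less_exp[of "k + 2"] by linarith
    also have "\<dots> < coset_ord G L (g k)" using that by (simp add: I_def)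
    finally show ?thesis using coset_ord_pos(2)[OF L, of "g k"] by simp
  qed
  then have I: "I \<subseteq> {..<?m}" by auto
  then have finI: "finite I" using finite_subset by blast
  have "\<exists>Y. finite Y \<and> Y \<subseteq> L \<and> card Y * coset_ord G L (g k) \<le> ?m \<and>
    (\<forall>\<phi> q z. \<phi> \<in> mod_homs G L q \<longrightarrow> z \<in> carrier G \<longrightarrow> (\<forall>y\<in>Y. \<phi> y = 0) \<longrightarrow>
       \<phi> (inv z \<otimes> g k [^] coset_ord G L (g k) \<otimes> z) = 0)" for k
    by (rule conjugate_representatives[OF L g_closed[of k]]) blast
  then obtain Y where Y: "\<And>k. finite (Y k)" "\<And>k. Y k \<subseteq> L"
    "\<And>k. card (Y k) * coset_ord G L (g k) \<le> ?m"
    "\<And>k \<phi> q z. \<phi> \<in> mod_homs G L q \<Longrightarrow> z \<in> carrier G \<Longrightarrow> \<forall>y\<in>Y k. \<phi> y = 0 \<Longrightarrow>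
       \<phi> (inv z \<otimes> g k [^] coset_ord G L (g k) \<otimes> z) = 0"
    by metis
  define U where "U = (\<Union>k\<in>I. Y k)"
  have U: "finite U" "U \<subseteq> L" using finI Y(1,2) by (auto simp: U_def)
  have Yk: "real (card (Y k)) \<le> real ?m * (1 / 2 ^ (k + 2))" if "k \<in> I" for k
  proof -
    have "card (Y k) * 2 ^ (k + 2) \<le> card (Y k) * coset_ord G L (g k)"
      using that by (intro mult_le_mono2) (simp add: I_def)
    then have "card (Y k) * 2 ^ (k + 2) \<le> ?m" using Y(3)[of k] by linarith
    then have "real (card (Y k) * 2 ^ (k + 2)) \<le> real ?m" by (rule of_nat_mono)
    then show ?thesis by (simp add: field_simps)
  qed
  have "real (card U) \<le> (\<Sum>k\<in>I. real (card (Y k)))"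
    using card_UN_le[OF finI, of Y] unfolding U_def of_nat_sum[symmetric] by (rule of_nat_mono)
  also have "\<dots> \<le> (\<Sum>k\<in>I. real ?m * (1 / 2 ^ (k + 2)))" by (rule sum_mono[OF Yk])
  also have "\<dots> \<le> (\<Sum>k<?m. real ?m * (1 / 2 ^ (k + 2)))"
    by (rule sum_mono2) (use I in auto)
  also have "\<dots> = real ?m * (\<Sum>k<?m. 1 / 2 ^ (k + 2))" by (rule sum_distrib_left[symmetric])
  also have "\<dots> \<le> real ?m * (1 / 2)" by (rule mult_left_mono[OF sum_inverse_powers_le]) simp
  finally have cU: "2 * card U \<le> ?m" by linarith
  have LS: "subgroup L G" using L(1) normal_imp_subgroup by blast
  have q0: "q > 0" using q prime_gt_0_nat by blast
  have fin: "finite (mod_homs G L q)"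
    using finite_mod_homs[OF LS L(2) q0 finite_gens gens_closed gens] .
  have "{\<phi> \<in> mod_homs G L q. \<forall>y\<in>U. \<phi> y = 0} \<subseteq> relator_homs L q"
    using Y(4) by (fastforce simp: relator_homs_def relators_def U_def I_def)
  then have "card {\<phi> \<in> mod_homs G L q. \<forall>y\<in>U. \<phi> y = 0} \<le> card (relator_homs L q)"
    using fin by (intro card_mono) (auto simp: relator_homs_def)
  then have "card (mod_homs G L q) \<le> card (relator_homs L q) * q ^ card U"
    using card_mod_homs_vanishing[OF LS q0 U fin] by (meson le_trans mult_le_mono1)
  then have "q ^ (?m + 1) \<le> card (relator_homs L q) * q ^ card U"
    using abundant[OF LS L(2) q] by linarith
  moreover have "q ^ (?m + 1) = q ^ (?m + 1 - card U) * q ^ card U"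
    using cU by (simp flip: power_add)
  ultimately have "q ^ (?m + 1 - card U) \<le> card (relator_homs L q)" using q0 by simp
  then show thesis using that[of "?m + 1 - card U"] cU by simp
qed

lemma next_term_subset: "next_term L q \<subseteq> L"
  by (auto simp: next_term_def)

lemma relators_next_term:
  assumes "L \<lhd> G"
  shows "relators L \<subseteq> next_term L q"
  using relators_subset[OF assms] by (auto simp: next_term_def relator_homs_def)

lemma next_term_subgroup:
  assumes L: "L \<lhd> G"
  shows "subgroup (next_term L q) G"
proof -
  interpret L: normal L G by fact
  show ?thesis
  proof (rule subgroupI)
    show "next_term L q \<subseteq> carrier G" using next_term_subset L.subset by blast
    have "\<one> \<in> next_term L q"
      using mod_homs_one[OF L.subgroup_axioms] by (auto simp: next_term_def relator_homs_def)
    then show "next_term L q \<noteq> {}" by blast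
  next
    fix a assume a: "a \<in> next_term L q"
    then have aL: "a \<in> L" using next_term_subset by blast
    have "\<phi> (inv a) = 0" if "\<phi> \<in> relator_homs L q" for \<phi>
    proof -
      have "\<phi> a = 0" using a that by (simp add: next_term_def)
      then show ?thesis
        using mod_homs_inv[OF L.subgroup_axioms _ aL, of \<phi> q] that by (simp add: relator_homs_def)
    qed
    then show "inv a \<in> next_term L q" using aL by (simp add: next_term_def)
  next
    fix a b assume ab: "a \<in> next_term L q" "b \<in> next_term L q"
    then have L: "a \<in> L" "b \<in> L" using next_term_subset by blast+
    have "\<phi> (a \<otimes> b) = 0" if "\<phi> \<in> relator_homs L q" for \<phi>
    proof -
      have "\<phi> a = 0" "\<phi> b = 0" using ab that by (simp_all add: next_term_def)
      then show ?thesis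
        using mod_homs_mult[OF _ L, of \<phi> q] that by (simp add: relator_homs_def)
    qed
    then show "a \<otimes> b \<in> next_term L q" using L by (simp add: next_term_def)
  qed
qed

text \<open>Composition with a conjugation sends \<open>relator_homs L q\<close> to itself, because
  the relators are closed under conjugation.\<close>

lemma next_term_normal:
  assumes L: "L \<lhd> G"
  shows "next_term L q \<lhd> G"
  unfolding normal_inv_iff
proof (intro conjI ballI next_term_subgroup[OF L])
  interpret L: normal L G by fact
  fix y x assume y: "y \<in> carrier G" and x: "x \<in> next_term L q"
  have xL: "x \<in> L" using x next_term_subset by blast
  have "\<phi> (y \<otimes> x \<otimes> inv y) = 0" if \<phi>: "\<phi> \<in> relator_homs L q" for \<phi>
  proof -
    define \<psi> where "\<psi> = restrict (\<lambda>z. \<phi> (y \<otimes> z \<otimes> inv y)) L"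
    have m: "\<phi> \<in> mod_homs G L q" using \<phi> by (simp add: relator_homs_def)
    have "\<psi> \<in> mod_homs G L q"
      unfolding mod_homs_def
    proof (intro CollectI conjI ballI)
      show "\<psi> \<in> L \<rightarrow>\<^sub>E {0..<int q}"
        using mod_homs_range[OF m] L.inv_op_closed2[OF y] by (auto simp: \<psi>_def)
      fix a b assume ab: "a \<in> L" "b \<in> L"
      have "y \<otimes> (a \<otimes> b) \<otimes> inv y = (y \<otimes> a \<otimes> inv y) \<otimes> (y \<otimes> b \<otimes> inv y)"
        using y ab by (simp add: m_assoc mult_inv_cancel)
      then show "\<psi> (a \<otimes> b) = (\<psi> a + \<psi> b) mod int q"
        using mod_homs_mult[OF m L.inv_op_closed2[OF y ab(1)] L.inv_op_closed2[OF y ab(2)]] ab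
        by (simp add: \<psi>_def)
    qed
    moreover have "\<psi> s = 0" if "s \<in> relators L" for s
      using \<phi> relators_conj[OF L that y] relators_subset[OF L] that by (auto simp: \<psi>_def relator_homs_def)
    ultimately have "\<psi> x = 0" using x by (simp add: next_term_def relator_homs_def)
    then show ?thesis using xL by (simp add: \<psi>_def)
  qed
  then show "y \<otimes> x \<otimes> inv y \<in> next_term L q"
    using L.inv_op_closed2[OF y xL] by (simp add: next_term_def)
qed

text \<open>A coset of \<open>next_term L q\<close> is determined by the coset \<open>L #> x\<close>
  and by the values of the finitely many \<open>relator_homs\<close> at the \<open>L\<close>-part of
  \<open>x\<close>.\<close>

lemma next_term_finite_index:
  assumes L: "L \<lhd> G" "finite (rcosets L)" and q: "prime q"
  shows "finite (rcosets (next_term L q))"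
proof -
  interpret L: normal L G by fact
  let ?N = "next_term L q"
  have N: "subgroup ?N G" using next_term_subgroup[OF L(1)] .
  have fin: "finite (relator_homs L q)"
    using finite_mod_homs[OF L.subgroup_axioms L(2) prime_gt_0_nat[OF q] finite_gens gens_closed gens]
    by (simp add: relator_homs_def)
  define F where "F x = (L #> x, restrict (\<lambda>\<phi>. \<phi> (x \<otimes> inv (coset_rep (L #> x)))) (relator_homs L q))" for x
  have "inj_on (\<lambda>C. F (coset_rep C)) (rcosets ?N)"
  proof (rule inj_onI)
    fix C D assume C: "C \<in> rcosets ?N" and D: "D \<in> rcosets ?N" and eq: "F (coset_rep C) = F (coset_rep D)"
    define x y t where "x = coset_rep C" and "y = coset_rep D" and "t = coset_rep (L #> coset_rep C)"
    have x: "x \<in> carrier G" "?N #> x = C" and y: "y \<in> carrier G" "?N #> y = D"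
      using coset_rep[OF N C] coset_rep[OF N D] by (simp_all add: x_def y_def)
    have e: "L #> x = L #> y" using eq by (simp add: F_def x_def y_def)
    have t: "t \<in> carrier G" using coset_rep(1)[OF L.subgroup_axioms, of "L #> x"] x(1)
      by (auto simp: t_def x_def RCOSETS_def)
    have xt: "x \<otimes> inv t \<in> L" "y \<otimes> inv t \<in> L"
      using mult_inv_coset_rep[OF L.subgroup_axioms x(1)] mult_inv_coset_rep[OF L.subgroup_axioms y(1)] e
      by (simp_all add: t_def x_def)
    have xy: "x \<otimes> inv y = (x \<otimes> inv t) \<otimes> inv (y \<otimes> inv t)"
      using x y t by (simp add: inv_mult_group m_assoc mult_inv_cancel)
    have "\<phi> (x \<otimes> inv y) = 0" if \<phi>: "\<phi> \<in> relator_homs L q" for \<phi>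
    proof -
      have m: "\<phi> \<in> mod_homs G L q" using \<phi> by (simp add: relator_homs_def)
      have "\<phi> (x \<otimes> inv t) = \<phi> (y \<otimes> inv t)"
        using fun_cong[of _ _ \<phi>, OF arg_cong[OF eq, of snd]] \<phi> e by (simp add: F_def t_def x_def y_def)
      then show ?thesis
        using mod_homs_mult[OF m xt(1) L.m_inv_closed[OF xt(2)]] mod_homs_inv[OF L.subgroup_axioms m xt(2)]
        by (simp add: xy mod_simps)
    qed
    then have "x \<otimes> inv y \<in> ?N" using xt L.m_closed[OF xt(1) L.m_inv_closed[OF xt(2)]]
      by (simp add: next_term_def xy)
    then show "C = D" using rcos_eq_iff[OF N x(1) y(1)] x y by simp
  qed
  moreover have "(\<lambda>C. F (coset_rep C)) ` (rcosets ?N) \<subseteq> (rcosets L) \<times> (relator_homs L q \<rightarrow>\<^sub>E {0..<int q})"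
  proof (rule image_subsetI)
    fix C assume "C \<in> rcosets ?N"
    then have c: "coset_rep C \<in> carrier G" using coset_rep[OF N] by blast
    then show "F (coset_rep C) \<in> (rcosets L) \<times> (relator_homs L q \<rightarrow>\<^sub>E {0..<int q})"
      using mod_homs_range[OF _ mult_inv_coset_rep[OF L.subgroup_axioms c]]
      by (auto simp: F_def RCOSETS_def relator_homs_def)
  qed
  moreover have "finite ((rcosets L) \<times> (relator_homs L q \<rightarrow>\<^sub>E {0..<int q}))"
    using L(2) fin by (auto intro: finite_PiE)
  ultimately show ?thesis by (meson finite_imageD finite_subset)
qed

lemma pow_mem_next_term:
  assumes "L \<lhd> G" "x \<in> L"
  shows "x [^] q \<in> next_term L q"
proof -
  interpret L: normal L G by fact
  have "x [^] q \<in> L" using subgroup_int_pow_closed[OF L.subgroup_axioms assms(2), of "int q"]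
    by (simp add: int_pow_int)
  moreover have "\<phi> (x [^] q) = 0" if "\<phi> \<in> relator_homs L q" for \<phi>
    using mod_homs_pow[OF L.subgroup_axioms _ assms(2), of \<phi> q q] that
    by (simp add: relator_homs_def)
  ultimately show ?thesis by (simp add: next_term_def)
qed

lemma commutator_mem_next_term:
  assumes "L \<lhd> G" "x \<in> L" "y \<in> L"
  shows "x \<otimes> y \<otimes> inv (y \<otimes> x) \<in> next_term L q"
proof -
  interpret L: normal L G by fact
  have xy: "x \<otimes> y \<in> L" "y \<otimes> x \<in> L" using assms by auto
  have "\<phi> (x \<otimes> y \<otimes> inv (y \<otimes> x)) = 0" if m: "\<phi> \<in> mod_homs G L q" for \<phi>
    using mod_homs_mult[OF m xy(1) L.m_inv_closed[OF xy(2)]] mod_homs_inv[OF L.subgroup_axioms m xy(2)]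
      mod_homs_mult[OF m assms(2,3)] mod_homs_mult[OF m assms(3,2)]
    by (simp add: mod_simps add.commute)
  then show ?thesis using xy by (simp add: next_term_def relator_homs_def)
qed

section \<open>The whole series and its residual\<close>

lemma series_props: "series i \<lhd> G \<and> finite (rcosets (series i))"
proof (induction i)
  case 0
  have "rcosets (carrier G) = {carrier G}"
    using coset_join2[OF _ subgroup_self] one_closed by (auto simp: RCOSETS_def)
  then show ?case using normal_self by simp
next
  case (Suc i)
  then show ?case using next_term_normal next_term_finite_index prime_p by simp
qed

lemmas series_normal = series_props[THEN conjunct1] and series_finite_index = series_props[THEN conjunct2]

lemma series_Suc_subset: "series (Suc i) \<subseteq> series i"
  using next_term_subset by auto

lemma series_antimono: "i \<le> j \<Longrightarrow> series j \<subseteq> series i"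
  using lift_Suc_antimono_le[of "series" i j] series_Suc_subset by blast

text \<open>Once the power of \<open>g k\<close> is a relator, it lies in the next term. The order
  of \<open>g k\<close> modulo the next term is therefore unchanged, so the same power is imposed
  again.\<close>

lemma relators_series_mono: "i \<le> j \<Longrightarrow> relators (series i) \<subseteq> relators (series j)"
proof (induction rule: dec_induct)
  case (step j)
  have "relators (series j) \<subseteq> relators (series (Suc j))"
  proof
    fix s assume s: "s \<in> relators (series j)"
    then obtain z k where zk: "s = inv z \<otimes> (g k [^] coset_ord G (series j) (g k)) \<otimes> z" "z \<in> carrier G"
      "2 ^ (k + 2) < coset_ord G (series j) (g k)"
      by (auto simp: relators_def)
    have sub: "relators (series j) \<subseteq> series (Suc j)"
      using relators_next_term[OF series_normal] relators_subset[OF series_normal] by simp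
    have "inv \<one> \<otimes> (g k [^] coset_ord G (series j) (g k)) \<otimes> \<one> \<in> relators (series j)"
      using zk(3) unfolding relators_def by blast
    then have "g k [^] coset_ord G (series j) (g k) \<in> series (Suc j)" using sub by auto
    then have eq: "coset_ord G (series (Suc j)) (g k) = coset_ord G (series j) (g k)"
      using pow_mem_iff_coset_ord[OF series_normal g_closed]
        coset_ord_dvd[OF series_normal series_normal series_Suc_subset g_closed] by (meson dvd_antisym)
    have "s = inv z \<otimes> (g k [^] coset_ord G (series (Suc j)) (g k)) \<otimes> z"
      "2 ^ (k + 2) < coset_ord G (series (Suc j)) (g k)"
      using zk by (simp_all only: eq)
    then show "s \<in> relators (series (Suc j))" using zk(2) unfolding relators_def by blast
  qed
  with step.IH show ?case by blast
qed simp

lemma relators_residual: "relators (series i) \<subseteq> residual"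
  unfolding residual_def
proof (rule INT_greatest)
  fix j
  show "relators (series i) \<subseteq> series j"
  proof (cases "i \<le> j")
    case True
    then show ?thesis using relators_series_mono relators_subset[OF series_normal] by blast
  next
    case False
    then show ?thesis using series_antimono[of j i] relators_subset[OF series_normal, of i] by auto
  qed
qed

lemma residual_subset: "residual \<subseteq> series i"
  by (auto simp: residual_def)

lemma residual_subgroup: "subgroup residual G"
  unfolding residual_def using series_normal normal_imp_subgroup
  by (intro subgroups_Inter) auto

lemma residual_normal: "residual \<lhd> G"
  unfolding normal_inv_iff
proof (intro conjI ballI residual_subgroup)
  fix x h assume "x \<in> carrier G" "h \<in> residual"
  then show "x \<otimes> h \<otimes> inv x \<in> residual"
    using normal.inv_op_closed2[OF series_normal] by (auto simp: residual_def)
qed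

text \<open>The stage \<open>i\<close> is one at which a power of \<open>x\<close> is imposed as a
  relator, or else one at which the bounded orders reach their maximum. In the latter case the order
  stays constant from \<open>i\<close> on, as each order divides the later ones.\<close>

lemma torsion_mod_residual:
  assumes "x \<in> carrier G"
  obtains i where "x [^] coset_ord G (series i) x \<in> residual"
proof -
  obtain k where k: "x = g k" using assms enum by blast
  let ?c = "\<lambda>i. coset_ord G (series i) x"
  show thesis
  proof (cases "\<exists>i. 2 ^ (k + 2) < ?c i")
    case True
    then obtain i where i: "2 ^ (k + 2) < ?c i" by blast
    have "inv \<one> \<otimes> (x [^] ?c i) \<otimes> \<one> \<in> relators (series i)"
      using i unfolding k relators_def by blast
    then have "x [^] ?c i \<in> relators (series i)" using assms by simp
    then show thesis using that relators_residual by blast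
  next
    case False
    then have "range ?c \<subseteq> {..2 ^ (k + 2)}" by (auto simp: not_less)
    then have fin: "finite (range ?c)" using finite_subset by blast
    then have "Max (range ?c) \<in> range ?c" by (intro Max_in) auto
    then obtain i where i: "?c i = Max (range ?c)" by auto
    have "x [^] ?c i \<in> series j" for j
    proof (cases "i \<le> j")
      case True
      have "?c i dvd ?c j" using coset_ord_dvd[OF series_normal series_normal series_antimono[OF True] assms] .
      moreover have "?c j \<le> ?c i" using fin i by simp
      moreover have "?c j > 0" using coset_ord_pos(1)[OF series_normal series_finite_index assms] .
      ultimately have "?c j = ?c i" by (meson dvd_imp_le le_antisym)
      then show ?thesis using pow_coset_ord_mem[OF series_normal[of j] assms] by simp
    next
      case False
      then show ?thesis using pow_coset_ord_mem[OF series_normal[of i] assms] series_antimono[of j i] by auto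
    qed
    then show thesis using that[of i] by (auto simp: residual_def)
  qed
qed

text \<open>Up to term \<open>j\<close> the exponent 1 suffices. Beyond it, an active step to term
  \<open>Suc l\<close> costs a factor \<open>p (Suc l)\<close> by \<open>pow_mem_next_term\<close>,
  and other steps cost nothing.\<close>

lemma prime_power_pow_mem_series:
  assumes "x \<in> series j"
  shows "\<exists>M>0. x [^] (M::nat) \<in> series l \<and> (\<forall>r. prime r \<longrightarrow> r dvd M \<longrightarrow> (\<exists>i\<in>A. j < i \<and> r = p i))"
proof (induction l)
  case 0
  have "x [^] (1::nat) \<in> series 0"
    using assms subgroup.subset[OF normal_imp_subgroup[OF series_normal[of j]]] by auto
  then show ?case by (intro exI[of _ 1]) auto
next
  case (Suc l)
  then obtain M :: nat where M: "M > 0" "x [^] M \<in> series l"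
    "\<And>r. prime r \<Longrightarrow> r dvd M \<Longrightarrow> \<exists>i\<in>A. j < i \<and> r = p i" by blast
  have xc: "x \<in> carrier G"
    using assms subgroup.subset[OF normal_imp_subgroup[OF series_normal[of j]]] by auto
  consider "Suc l \<notin> A" | "Suc l \<in> A" "Suc l \<le> j" | "Suc l \<in> A" "j < Suc l" by linarith
  then show ?case
  proof cases
    case 1
    then show ?thesis using M by (intro exI[of _ M]) auto
  next
    case 2
    then have "x [^] (1::nat) \<in> series (Suc l)" using assms series_antimono[of "Suc l" j] xc by auto
    then show ?thesis by (intro exI[of _ 1]) auto
  next
    case 3
    have "(x [^] M) [^] p (Suc l) \<in> series (Suc l)"
      using pow_mem_next_term[OF series_normal M(2)] 3 by simp
    then have "x [^] (M * p (Suc l)) \<in> series (Suc l)" using xc by (simp only: nat_pow_pow)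
    moreover have "\<exists>i\<in>A. j < i \<and> r = p i" if r: "prime r" "r dvd M * p (Suc l)" for r
    proof (cases "r dvd M")
      case False
      then have "r dvd p (Suc l)" using r prime_dvd_mult_iff by blast
      then have "r = p (Suc l)" using r(1) prime_p[OF 3(1)] by (simp add: primes_dvd_imp_eq)
      then show ?thesis using 3 by blast
    qed (use M(3) r in blast)
    ultimately show ?thesis
      using M(1) prime_gt_0_nat[OF prime_p[OF 3(1)]] by (intro exI[of _ "M * p (Suc l)"]) auto
  qed
qed

text \<open>The exponent \<open>c\<close> is the order of \<open>x\<close> modulo a term where
  \<open>torsion_mod_residual\<close> applies. It divides the exponent \<open>M\<close> of the
  preceding lemma for that term and inherits the restriction on prime factors.\<close>

lemma torsion_order_primes:
  assumes x: "x \<in> series j"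
  shows "\<exists>c>0. x [^] (c::nat) \<in> residual \<and> (\<forall>r. prime r \<longrightarrow> r dvd c \<longrightarrow> (\<exists>i\<in>A. j < i \<and> r = p i))"
proof -
  have xc: "x \<in> carrier G"
    using x subgroup.subset[OF normal_imp_subgroup[OF series_normal[of j]]] by auto
  obtain i where i: "x [^] coset_ord G (series i) x \<in> residual" using torsion_mod_residual[OF xc] .
  obtain M :: nat where M: "x [^] M \<in> series i" "\<forall>r. prime r \<longrightarrow> r dvd M \<longrightarrow> (\<exists>i\<in>A. j < i \<and> r = p i)"
    using prime_power_pow_mem_series[OF x, of i] by blast
  have "coset_ord G (series i) x dvd M" using pow_mem_iff_coset_ord[OF series_normal xc] M(1) by blast
  then have "\<forall>r. prime r \<longrightarrow> r dvd coset_ord G (series i) x \<longrightarrow> (\<exists>i\<in>A. j < i \<and> r = p i)"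
    using M(2) dvd_trans by blast
  then show ?thesis
    using i coset_ord_pos(1)[OF series_normal series_finite_index xc, of i] by blast
qed

text \<open>The order modulo the residual of an element of a late term has large prime factors only,
  whereas some power with a small exponent lies in \<open>K\<close>.\<close>

lemma series_subset_finite_index_inj:
  assumes inj: "inj_on p A" and K: "subgroup K G" "finite (rcosets K)" "residual \<subseteq> K"
  shows "\<exists>j. series j \<subseteq> K"
proof -
  let ?k = "card (rcosets K)"
  \<comment> \<open>By injectivity only finitely many active primes are at most the index of
    \<open>K\<close>; \<open>j\<close> is chosen past all of them.\<close>
  have "finite {i \<in> A. p i \<le> ?k}"
  proof (rule finite_imageD)
    show "finite (p ` {i \<in> A. p i \<le> ?k})" by (rule finite_subset[of _ "{..?k}"]) auto
    show "inj_on p {i \<in> A. p i \<le> ?k}" using inj by (rule inj_on_subset) auto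
  qed
  then obtain j where "\<forall>i\<in>{i \<in> A. p i \<le> ?k}. i \<le> j"
    by (auto simp: finite_nat_set_iff_bounded_le)
  then have j: "\<And>i. i \<in> A \<Longrightarrow> p i \<le> ?k \<Longrightarrow> i \<le> j" by blast
  have "series j \<subseteq> K"
  proof
    fix x assume x: "x \<in> series j"
    have xc: "x \<in> carrier G"
      using x subgroup.subset[OF normal_imp_subgroup[OF series_normal[of j]]] by auto
    obtain c :: nat where c: "x [^] c \<in> residual" "c > 0"
      "\<And>r. prime r \<Longrightarrow> r dvd c \<Longrightarrow> \<exists>i\<in>A. j < i \<and> r = p i"
      using torsion_order_primes[OF x] by blast
    obtain a :: nat where a: "0 < a" "a \<le> ?k" "x [^] a \<in> K"
      using pow_mem_finite_index[OF K(1,2) xc] .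
    have "coprime a c"
    proof (rule ccontr)
      assume "\<not> coprime a c"
      then obtain r where r: "prime r" "r dvd a" "r dvd c"
        using prime_factor_nat[of "gcd a c"] by (auto simp: coprime_iff_gcd_eq_1)
      have "r \<le> ?k" using dvd_imp_le[OF r(2) a(1)] a(2) by simp
      moreover obtain i where "i \<in> A" "j < i" "r = p i" using c(3)[OF r(1,3)] by blast
      ultimately show False using j[of i] by simp
    qed
    then show "x \<in> K" using pow_coprime_mem[OF K(1) xc a(3)] c(1) K(3) by blast
  qed
  then show ?thesis ..
qed

text \<open>As long as \<open>series i\<close> is not contained in the core \<open>C\<close> of \<open>K\<close>, its image in \<open>G / C\<close> is a
  nontrivial \<open>q\<close>-group, and so has a nontrivial homomorphism to the integers modulo \<open>q\<close>. Its
  kernel contains the relators, so the image of the next term of the series is smaller.\<close>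

lemma series_subset_finite_index_const:
  assumes q: "\<And>i. i \<in> A \<Longrightarrow> p i = q" and K: "subgroup K G" "finite (rcosets K)" "residual \<subseteq> K"
  shows "\<exists>j. series j \<subseteq> K"
proof -
  define C where "C = {x \<in> carrier G. \<forall>y\<in>carrier G. y \<otimes> x \<otimes> inv y \<in> K}"
  have C: "C \<lhd> G" "finite (rcosets C)" "C \<subseteq> K"
    unfolding C_def using normal_core[OF K(1,2)] by auto
  have RC: "residual \<subseteq> C"
  proof
    fix x assume x: "x \<in> residual"
    have "y \<otimes> x \<otimes> inv y \<in> K" if "y \<in> carrier G" for y
      using subsetD[OF K(3) normal.inv_op_closed2[OF residual_normal that x]] .
    then show "x \<in> C" using subgroup.mem_carrier[OF residual_subgroup x] by (simp add: C_def)
  qed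
  interpret C: normal C G by (rule C(1))
  interpret P: group "G Mod C" by (rule C.factorgroup_is_group)
  obtain i0 where "i0 \<in> A" using infinite_A by (metis finite.emptyI ex_in_conv)
  then have pq: "prime q" using q prime_p by metis
  \<comment> \<open>The images of the terms in the finite group \<open>G Mod C\<close>; their sizes
    drive the descent.\<close>
  let ?I = "\<lambda>i. (\<lambda>x. C #> x) ` series i"
  have fin: "finite (?I i)" for i
    by (rule finite_subset[OF _ C(2)])
      (use subgroup.subset[OF normal_imp_subgroup[OF series_normal[of i]]] in \<open>auto simp: RCOSETS_def\<close>)
  have drop: "card (?I (Suc i)) < card (?I i)" if iA: "Suc i \<in> A" and nt: "\<not> series i \<subseteq> C" for i
  proof -
    let ?L = "series i"
    have L: "subgroup ?L G" using normal_imp_subgroup[OF series_normal] .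
    have Lc: "?L \<subseteq> carrier G" using subgroup.subset[OF L] .
    interpret h: group_hom G "G Mod C" "\<lambda>x. C #> x"
      by (intro group_hom.intro group_hom_axioms.intro is_group P.is_group C.r_coset_hom_Mod)
    have S: "subgroup (?I i) (G Mod C)" using h.subgroup_img_is_subgroup[OF L] .
    let ?S = "(G Mod C)\<lparr>carrier := ?I i\<rparr>"
    interpret S: group ?S using subgroup.subgroup_is_group[OF S P.is_group] .
    have "carrier ?S \<noteq> {\<one>\<^bsub>?S\<^esub>}"
    proof
      assume e: "carrier ?S = {\<one>\<^bsub>?S\<^esub>}"
      have "?L \<subseteq> C"
      proof
        fix x assume x: "x \<in> ?L"
        then have "C #> x = C" using e by auto
        then show "x \<in> C" using rcos_self[OF _ C.subgroup_axioms, of x] x Lc by auto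
      qed
      then show False using nt by blast
    qed
    moreover have "\<exists>n. y [^]\<^bsub>?S\<^esub> (q ^ n) = \<one>\<^bsub>?S\<^esub>" if "y \<in> carrier ?S" for y
    proof -
      obtain x where x: "x \<in> ?L" "y = C #> x" using \<open>y \<in> carrier ?S\<close> by auto
      have xc: "x \<in> carrier G" using x Lc by blast
      obtain c :: nat where c: "x [^] c \<in> residual" "c > 0"
        "\<And>r. prime r \<Longrightarrow> r dvd c \<Longrightarrow> \<exists>i'\<in>A. i < i' \<and> r = p i'"
        using torsion_order_primes[OF x(1)] by blast
      have "r = q" if "prime r" "r dvd c" for r using c(3)[OF that] q by blast
      then obtain n where "c = q ^ n" using prime_power_of_unique_prime[OF c(2)] by blast
      then have "C #> x [^] (q ^ n) = C" using coset_join2[OF _ C.subgroup_axioms] c(1) RC xc by auto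
      then show ?thesis
        using C.FactGroup_pow[OF xc, of "q ^ n"] x(2)
        by (auto simp flip: nat_pow_consistent P.nat_pow_consistent)
    qed
    ultimately obtain \<psi> y where \<psi>: "\<psi> \<in> mod_homs ?S (carrier ?S) q" and y: "y \<in> carrier ?S" "\<psi> y \<noteq> 0"
      using S.prime_power_group_hom[OF _ pq] fin[of i] by auto
    have \<psi>0: "\<psi> C = 0" using S.mod_homs_one[OF S.subgroup_self \<psi>] by simp
    define \<phi> where "\<phi> = restrict (\<lambda>x. \<psi> (C #> x)) ?L"
    have "\<phi> \<in> mod_homs G ?L q"
      unfolding mod_homs_def
    proof (intro CollectI conjI ballI)
      show "\<phi> \<in> ?L \<rightarrow>\<^sub>E {0..<int q}" using S.mod_homs_range[OF \<psi>] by (auto simp: \<phi>_def)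
      fix a b assume ab: "a \<in> ?L" "b \<in> ?L"
      have "C #> (a \<otimes> b) = (C #> a) <#> (C #> b)" using C.rcos_sum ab Lc by (simp add: subsetD)
      then show "\<phi> (a \<otimes> b) = (\<phi> a + \<phi> b) mod int q"
        using S.mod_homs_mult[OF \<psi>, of "C #> a" "C #> b"] ab subgroup.m_closed[OF L] by (simp add: \<phi>_def)
    qed
    moreover have "\<phi> s = 0" if "s \<in> relators ?L" for s
    proof -
      have "s \<in> C" "s \<in> ?L" using that relators_residual RC relators_subset[OF series_normal] by blast+
      then show ?thesis using coset_join2[OF _ C.subgroup_axioms, of s] \<psi>0 by (simp add: \<phi>_def)
    qed
    ultimately have \<phi>: "\<phi> \<in> relator_homs ?L q" by (simp add: relator_homs_def)
    have "y \<notin> ?I (Suc i)"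
    proof
      assume "y \<in> ?I (Suc i)"
      then obtain x where x: "x \<in> next_term ?L q" "y = C #> x" using iA q[OF iA] by auto
      then have "\<phi> x = 0" "x \<in> ?L" using \<phi> by (auto simp: next_term_def)
      then show False using y(2) x(2) by (simp add: \<phi>_def)
    qed
    moreover have "y \<in> ?I i" using y(1) by simp
    moreover have "?I (Suc i) \<subseteq> ?I i" by (rule image_mono[OF series_Suc_subset])
    ultimately have "?I (Suc i) \<subset> ?I i" by blast
    then show ?thesis by (rule psubset_card_mono[OF fin])
  qed
  have mono: "card (?I j) \<le> card (?I i)" if "i \<le> j" for i j
    by (rule card_mono[OF fin image_mono[OF series_antimono[OF that]]])
  \<comment> \<open>A stage with the smallest image. A later active step would make the image
    smaller still unless the term before it already lies in \<open>C\<close>.\<close>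
  define j where "j = (ARG_MIN (\<lambda>i. card (?I i)) i. True)"
  have j: "card (?I j) \<le> card (?I i)" for i
    unfolding j_def by (rule arg_min_nat_le) simp
  obtain i where i: "j \<le> i" "Suc i \<in> A"
    using infinite_A unfolding infinite_nat_iff_unbounded by (metis Suc_le_D Suc_leI less_Suc_eq_le)
  have "series i \<subseteq> C"
  proof (rule ccontr)
    assume "\<not> series i \<subseteq> C"
    from drop[OF i(2) this] show False using j[of "Suc i"] mono[OF i(1)] by linarith
  qed
  then show ?thesis using C(3) by blast
qed

text \<open>Put \<open>l = [K : L]\<close> and \<open>d = card Y\<close>. The homomorphisms counted
  number at least \<open>q ^ j\<close> and at most \<open>q ^ (l * d + 1 - l)\<close>. Since
  \<open>2 * j\<close> is at least \<open>[G : K] * l + 2\<close>, dividing by \<open>l\<close>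
  gives the claim.\<close>

lemma min_generators_ge:
  assumes A: "inj_on p A \<or> (\<exists>q. \<forall>i\<in>A. p i = q)"
    and K: "subgroup K G" "finite (rcosets K)" "residual \<subseteq> K"
    and Y: "finite Y" "Y \<subseteq> K" "K \<subseteq> generate G (residual \<union> Y)"
  shows "card (rcosets K) + 2 \<le> 2 * card Y"
proof -
  have "\<exists>j. series j \<subseteq> K"
    using A series_subset_finite_index_inj[OF _ K] series_subset_finite_index_const[OF _ K] by blast
  then obtain j0 where j0: "series j0 \<subseteq> K" ..
  \<comment> \<open>An active index makes \<open>series (Suc i)\<close> equal to
    \<open>next_term L q\<close>. It contains the residual, so all of
    \<open>relator_homs L q\<close> vanish there, and the residual can serve as \<open>U\<close> in
    the counting bound.\<close>
  obtain i where i: "j0 \<le> i" "Suc i \<in> A"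
    using infinite_A unfolding infinite_nat_iff_unbounded by (metis Suc_le_D Suc_leI less_Suc_eq_le)
  define L q where "L = series i" and "q = p (Suc i)"
  have L: "L \<lhd> G" "finite (rcosets L)" "L \<subseteq> K"
    using series_normal series_finite_index series_antimono[OF i(1)] j0 by (auto simp: L_def)
  have q: "prime q" using prime_p[OF i(2)] by (simp add: q_def)
  obtain j where j: "card (rcosets L) + 2 \<le> 2 * j" "q ^ j \<le> card (relator_homs L q)"
    using card_relator_homs[OF L(1,2) q] .
  let ?K = "G\<lparr>carrier := K\<rparr>"
  interpret K: group ?K using subgroup.subgroup_is_group[OF K(1) is_group] .
  have LS: "subgroup L G" using L(1) normal_imp_subgroup by blast
  have LK: "subgroup L ?K" using subgroup_incl[OF LS K(1) L(3)] .
  note idx = card_rcosets_mult_le[OF LS K(1) L(3,2)]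
  let ?m = "card (rcosets\<^bsub>?K\<^esub> L)"
  have RL: "residual \<subseteq> L" using residual_subset by (simp add: L_def)
  have Kc: "K \<subseteq> carrier G" using subgroup.subset[OF K(1)] .
  have "card (relator_homs L q) * q ^ ?m \<le> q ^ (?m * card Y + 1)"
  proof (rule K.card_mod_homs_le[OF LK idx(2), where U = residual])
    show "q > 0" using prime_gt_0_nat[OF q] .
    show "residual \<subseteq> L" by (rule RL)
    show "finite Y" "Y \<subseteq> carrier ?K" using Y by auto
    fix x u assume "x \<in> carrier ?K" "u \<in> residual"
    then show "x \<otimes>\<^bsub>?K\<^esub> u \<otimes>\<^bsub>?K\<^esub> inv\<^bsub>?K\<^esub> x \<in> residual"
      using normal.inv_op_closed2[OF residual_normal, of x u] K(1) Kc by (auto simp: m_inv_consistent)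
  next
    have RY: "residual \<union> Y \<subseteq> K" using K(3) Y(2) by blast
    show "generate ?K (residual \<union> Y) = carrier ?K"
      using generate_consistent[OF RY K(1)] Y(3) generate_subgroup_incl[OF RY K(1)] by auto
    have "mod_homs ?K L q = mod_homs G L q" by (simp add: mod_homs_def)
    then show "relator_homs L q \<subseteq> mod_homs ?K L q" by (auto simp: relator_homs_def)
    fix \<phi> u assume \<phi>: "\<phi> \<in> relator_homs L q" and u: "u \<in> residual"
    have "u \<in> next_term L q" using u residual_subset[of "Suc i"] i(2) by (auto simp: L_def q_def)
    then show "\<phi> u = 0" using \<phi> by (auto simp: next_term_def)
  qed
  then have "q ^ (j + ?m) \<le> q ^ (?m * card Y + 1)"
    unfolding power_add[of q j] using j(2) by (meson le_trans mult_le_mono1)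
  then have "j + ?m \<le> ?m * card Y + 1"
    by (rule power_le_imp_le_exp[OF prime_gt_1_nat[OF q]])
  then have "?m * card (rcosets K) + 2 * ?m \<le> 2 * (?m * card Y)"
    using j(1) idx(3) by (simp add: mult.commute)
  then have "?m * (card (rcosets K) + 2) \<le> ?m * (2 * card Y)" by (simp add: algebra_simps)
  moreover have "?m > 0"
    using idx(2) subgroup.subgroup_in_rcosets[OF LK K.is_group] by (auto simp: card_gt_0_iff)
  ultimately show ?thesis by (simp only: nat_mult_le_cancel1)
qed

end

section \<open>The quotient by the residual\<close>

text \<open>Powers and commutators make the factor abelian and killed by \<open>q\<close>. If some
  positive \<open>m < q\<close> killed it as well, coprimality would make it trivial, so in the
  remaining case the exponent is exactly \<open>q\<close>.\<close>

lemma (in group) elementary_abelian_factor: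
  assumes L: "subgroup L G" and N: "N \<lhd> G" "N \<subseteq> L" and q: "prime q"
    and pow: "\<And>x. x \<in> L \<Longrightarrow> x [^] q \<in> N"
    and comm: "\<And>x y. x \<in> L \<Longrightarrow> y \<in> L \<Longrightarrow> x \<otimes> y \<otimes> inv (y \<otimes> x) \<in> N"
  defines "F \<equiv> (G\<lparr>carrier := L\<rparr>) Mod N"
  shows "trivial_group F \<or> comm_group F \<and> has_exponent F q"
proof -
  let ?L = "G\<lparr>carrier := L\<rparr>"
  have NS: "subgroup N G" using N(1) normal_imp_subgroup by blast
  have Lc: "L \<subseteq> carrier G" using subgroup.subset[OF L] .
  interpret L: group ?L using subgroup.subgroup_is_group[OF L is_group] .
  have "N \<lhd> ?L" using normal_restrict_supergroup[OF L N] .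
  then interpret M: normal N ?L .
  interpret F: group F unfolding F_def by (rule M.factorgroup_is_group)
  have elt: "\<exists>x\<in>L. C = N #> x" if "C \<in> carrier F" for C
    using that by (auto simp: F_def carrier_FactGroup)
  have one: "\<one>\<^bsub>F\<^esub> = N" by (simp add: F_def)
  have fpow: "(N #> x) [^]\<^bsub>F\<^esub> (n::nat) = N #> x [^] n" if "x \<in> L" for x n
    using M.FactGroup_pow[of x n] that by (simp add: F_def flip: nat_pow_consistent)
  have fq: "C [^]\<^bsub>F\<^esub> q = \<one>\<^bsub>F\<^esub>" if C: "C \<in> carrier F" for C
  proof -
    obtain x where x: "x \<in> L" "C = N #> x" using elt[OF C] by blast
    show ?thesis using fpow[OF x(1), of q] coset_join2[OF _ NS pow[OF x(1)]] x Lc one by auto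
  qed
  have cg: "comm_group F"
  proof (rule F.group_comm_groupI)
    fix C D assume C: "C \<in> carrier F" and D: "D \<in> carrier F"
    obtain x y where x: "x \<in> L" "C = N #> x" and y: "y \<in> L" "D = N #> y"
      using elt[OF C] elt[OF D] by blast
    have xy: "x \<in> carrier G" "y \<in> carrier G" using x y Lc by auto
    have "N #> (x \<otimes> y) = N #> (y \<otimes> x)"
      using rcos_eq_iff[OF NS, of "x \<otimes> y" "y \<otimes> x"] comm[OF x(1) y(1)] xy by simp
    then show "C \<otimes>\<^bsub>F\<^esub> D = D \<otimes>\<^bsub>F\<^esub> C"
      using M.rcos_sum[of x y] M.rcos_sum[of y x] x y by (simp add: F_def)
  qed
  show ?thesis
  proof (cases "trivial_group F")
    case False
    have "\<exists>C\<in>carrier F. C [^]\<^bsub>F\<^esub> m \<noteq> \<one>\<^bsub>F\<^esub>" if m: "0 < m" "m < q" for m :: nat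
    proof (rule ccontr)
      assume a: "\<not> (\<exists>C\<in>carrier F. C [^]\<^bsub>F\<^esub> m \<noteq> \<one>\<^bsub>F\<^esub>)"
      have "coprime m q" using m q by (meson coprime_commute nat_dvd_not_less prime_imp_coprime)
      then have "C \<in> {\<one>\<^bsub>F\<^esub>}" if "C \<in> carrier F" for C
        using F.pow_coprime_mem[OF F.triv_subgroup that, of m q] a fq[OF that] that by blast
      then show False using False F.trivial_group_subset by blast
    qed
    then show ?thesis using cg fq prime_gt_0_nat[OF q] by (auto simp: has_exponent_def)
  qed simp
qed

locale residual_quotient = torsion_series +
  assumes A: "inj_on p A \<or> (\<exists>q. \<forall>i\<in>A. p i = q)"
begin

text \<open>The quotient group coded on the naturals. The cosets are countably many because
  \<open>g\<close> enumerates \<open>G\<close>, so \<open>to_nat_on\<close> is injective on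
  them.\<close>

definition proj :: "'a \<Rightarrow> nat" where
  "proj x = to_nat_on (rcosets residual) (residual #> x)"

definition quotient :: "nat monoid" where
  "quotient = image_group proj G"

lemma weak_group_morphism_proj: "weak_group_morphism proj residual G"
proof (rule weak_group_morphismsI[OF residual_normal])
  fix a b assume ab: "a \<in> carrier G" "b \<in> carrier G"
  have "rcosets residual = (\<lambda>x. residual #> x) ` range g" unfolding enum by (auto simp: RCOSETS_def)
  then have "countable (rcosets residual)" by simp
  then have "proj a = proj b \<longleftrightarrow> residual #> a = residual #> b"
    unfolding proj_def using ab subgroup.subset[OF residual_subgroup]
    by (intro to_nat_on_inj) (auto intro!: rcosetsI)
  then show "proj a = proj b \<longleftrightarrow> a \<otimes> inv b \<in> residual"
    using rcos_eq_iff[OF residual_subgroup ab] by simp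
qed

lemma carrier_quotient: "carrier quotient = proj ` carrier G"
  by (simp add: quotient_def image_group_carrier)

sublocale proj: group_hom G quotient proj
  unfolding quotient_def by (rule weak_group_morphism_group_hom[OF weak_group_morphism_proj])

lemma proj_eq_iff: "a \<in> carrier G \<Longrightarrow> b \<in> carrier G \<Longrightarrow> proj a = proj b \<longleftrightarrow> a \<otimes> inv b \<in> residual"
  by (rule weak_group_morphism.inj_mod_subgroup[OF weak_group_morphism_proj])

lemma proj_eq_one: "a \<in> residual \<Longrightarrow> proj a = \<one>\<^bsub>quotient\<^esub>"
  using proj_eq_iff[of a \<one>] subgroup.mem_carrier[OF residual_subgroup, of a] by simp

lemma generate_quotient: "generate quotient (proj ` X) = carrier quotient"
  using proj.generate_img[OF gens_closed] gens by (simp add: carrier_quotient)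

lemma torsion_quotient: "torsion_group quotient"
  unfolding torsion_group_def
proof
  fix y assume "y \<in> carrier quotient"
  then obtain x where x: "x \<in> carrier G" "y = proj x" by (auto simp: carrier_quotient)
  obtain i where i: "x [^] coset_ord G (series i) x \<in> residual" using torsion_mod_residual[OF x(1)] .
  then have "y [^]\<^bsub>quotient\<^esub> coset_ord G (series i) x = \<one>\<^bsub>quotient\<^esub>"
    using proj_eq_one[OF i] proj.hom_nat_pow[OF x(1)] x(2) by simp
  then show "\<exists>n>0. y [^]\<^bsub>quotient\<^esub> (n::nat) = \<one>\<^bsub>quotient\<^esub>"
    using coset_ord_pos(1)[OF series_normal series_finite_index x(1)] by blast
qed

lemma graded_quotient:
  assumes prime: "\<And>i. i \<ge> 1 \<Longrightarrow> prime (p i)"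
  shows "graded_group p quotient"
proof -
  define N where "N i = proj ` series i" for i
  have Nn: "N i \<lhd> quotient" for i
    unfolding N_def
    by (rule normal.surj_hom_normal_subgroup[OF series_normal proj.group_hom_axioms])
      (simp add: carrier_quotient)
  have sc: "x \<in> carrier G" if "x \<in> series i" for x i
    using subgroup.mem_carrier[OF normal_imp_subgroup[OF series_normal] that] .
  have Nmono: "N (Suc i) \<subseteq> N i" for i
    unfolding N_def by (rule image_mono[OF series_Suc_subset])
  have quot: "trivial_group F \<or> comm_group F \<and> has_exponent F (p (Suc i))"
    if "F = (quotient\<lparr>carrier := N i\<rparr>) Mod N (Suc i)" for F i
    unfolding that
  proof (rule proj.H.elementary_abelian_factor[OF normal_imp_subgroup[OF Nn] Nn Nmono])
    show "prime (p (Suc i))" using prime by simp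
    fix a assume "a \<in> N i"
    then obtain x where x: "x \<in> series i" "a = proj x" by (auto simp: N_def)
    \<comment> \<open>At active indices this is \<open>pow_mem_next_term\<close>; at the others the
      term repeats and closure under powers suffices. The commutators below are treated
      likewise.\<close>
    have "x [^] p (Suc i) \<in> series (Suc i)"
      using pow_mem_next_term[OF series_normal x(1)] subgroup_int_pow_closed[OF normal_imp_subgroup[OF series_normal] x(1), of "int (p (Suc i))"]
      by (simp add: int_pow_int)
    then have "proj (x [^] p (Suc i)) \<in> N (Suc i)" unfolding N_def by (rule imageI)
    then show "a [^]\<^bsub>quotient\<^esub> p (Suc i) \<in> N (Suc i)"
      using proj.hom_nat_pow[OF sc[OF x(1)], of "p (Suc i)"] x(2) by simp
    fix b assume "b \<in> N i"
    then obtain y where y: "y \<in> series i" "b = proj y" by (auto simp: N_def)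
    have "x \<otimes> y \<otimes> inv (y \<otimes> x) \<in> series (Suc i)"
      using commutator_mem_next_term[OF series_normal x(1) y(1)]
        subgroup.m_closed[OF normal_imp_subgroup[OF series_normal[of i]]]
        subgroup.m_inv_closed[OF normal_imp_subgroup[OF series_normal[of i]]] x(1) y(1) by simp
    then have "proj (x \<otimes> y \<otimes> inv (y \<otimes> x)) \<in> N (Suc i)" unfolding N_def by (rule imageI)
    then show "a \<otimes>\<^bsub>quotient\<^esub> b \<otimes>\<^bsub>quotient\<^esub> inv\<^bsub>quotient\<^esub> (b \<otimes>\<^bsub>quotient\<^esub> a) \<in> N (Suc i)"
      using sc[OF x(1)] sc[OF y(1)] x(2) y(2) by simp
  qed
  have "graded_series p quotient N"
    unfolding graded_series_def Let_def
  proof (intro conjI allI impI Nn)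
    show "N 0 = carrier quotient" by (simp add: N_def carrier_quotient)
    fix i :: nat assume "i \<ge> 1"
    then have i: "Suc (i - 1) = i" by simp
    show "N i \<subseteq> N (i - 1)" using Nmono[of "i - 1"] unfolding i .
    show "trivial_group ((quotient\<lparr>carrier := N (i - 1)\<rparr>) Mod N i) \<or>
      comm_group ((quotient\<lparr>carrier := N (i - 1)\<rparr>) Mod N i) \<and>
      has_exponent ((quotient\<lparr>carrier := N (i - 1)\<rparr>) Mod N i) (p i)"
      using quot[of _ "i - 1", OF refl] unfolding i .
  qed
  moreover have "(\<Inter>i. N i) = {\<one>\<^bsub>quotient\<^esub>}"
  proof
    show "{\<one>\<^bsub>quotient\<^esub>} \<subseteq> (\<Inter>i. N i)"
      using subgroup.one_closed[OF normal_imp_subgroup[OF Nn]] by blast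
    show "(\<Inter>i. N i) \<subseteq> {\<one>\<^bsub>quotient\<^esub>}"
    proof
      fix y assume y: "y \<in> (\<Inter>i. N i)"
      then have "y \<in> N 0" by blast
      then obtain x where x: "x \<in> carrier G" "y = proj x" by (auto simp: N_def)
      \<comment> \<open>Each term contains the residual, hence is the full preimage of its
        image.\<close>
      have "x \<in> series i" for i
      proof -
        have "y \<in> N i" using y by blast
        then obtain z where z: "z \<in> series i" "y = proj z" by (auto simp: N_def)
        have "x \<otimes> inv z \<in> series i"
          using proj_eq_iff[OF x(1) sc[OF z(1)]] x(2) z(2) residual_subset by auto
        then have "x \<otimes> inv z \<otimes> z \<in> series i"
          using subgroup.m_closed[OF normal_imp_subgroup[OF series_normal]] z(1) by blast
        then show ?thesis using x(1) sc[OF z(1)] by (simp add: m_assoc)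
      qed
      then show "y \<in> {\<one>\<^bsub>quotient\<^esub>}" using proj_eq_one[of x] x(2) by (simp add: residual_def)
    qed
  qed
  ultimately show ?thesis unfolding graded_group_def by blast
qed

text \<open>The preimage \<open>K'\<close> has the same index as \<open>K\<close>. Lifts of a
  minimal generating set of \<open>K\<close> generate \<open>K'\<close> together with the residual,
  so \<open>min_generators_ge\<close> applies.\<close>

lemma min_generators_quotient:
  assumes "finite_index_subgroup K quotient"
  shows "subgroup_index quotient K + 2 \<le> 2 * min_generators (quotient\<lparr>carrier := K\<rparr>)"
proof -
  have K: "subgroup K quotient" "finite (rcosets\<^bsub>quotient\<^esub> K)"
    using assms by (auto simp: finite_index_subgroup_def)
  define K' where "K' = {x \<in> carrier G. proj x \<in> K}"
  have K'S: "subgroup K' G"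
  proof (rule subgroupI)
    show "K' \<subseteq> carrier G" by (auto simp: K'_def)
    have "\<one> \<in> K'" using subgroup.one_closed[OF K(1)] by (simp add: K'_def)
    then show "K' \<noteq> {}" by blast
  next
    fix a assume "a \<in> K'"
    then show "inv a \<in> K'" using subgroup.m_inv_closed[OF K(1)] by (simp add: K'_def)
  next
    fix a b assume "a \<in> K'" "b \<in> K'"
    then show "a \<otimes> b \<in> K'" using subgroup.m_closed[OF K(1)] by (simp add: K'_def)
  qed
  have RK: "residual \<subseteq> K'"
    using subgroup.mem_carrier[OF residual_subgroup] proj_eq_one subgroup.one_closed[OF K(1)]
    by (auto simp: K'_def)
  have eq: "K #>\<^bsub>quotient\<^esub> proj x = K #>\<^bsub>quotient\<^esub> proj y \<longleftrightarrow> K' #> x = K' #> y"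
    if "x \<in> carrier G" "y \<in> carrier G" for x y
    using proj.H.rcos_eq_iff[OF K(1), of "proj x" "proj y"] rcos_eq_iff[OF K'S that] that
    by (simp add: K'_def)
  have "bij_betw (\<lambda>C. K #>\<^bsub>quotient\<^esub> proj (coset_rep C)) (rcosets K') (rcosets\<^bsub>quotient\<^esub> K)"
  proof (rule bij_betw_imageI)
    show "inj_on (\<lambda>C. K #>\<^bsub>quotient\<^esub> proj (coset_rep C)) (rcosets K')"
      using eq coset_rep[OF K'S] by (intro inj_onI) metis
    show "(\<lambda>C. K #>\<^bsub>quotient\<^esub> proj (coset_rep C)) ` (rcosets K') = rcosets\<^bsub>quotient\<^esub> K"
    proof (intro subset_antisym image_subsetI subsetI)
      fix C assume "C \<in> rcosets K'"
      then show "K #>\<^bsub>quotient\<^esub> proj (coset_rep C) \<in> rcosets\<^bsub>quotient\<^esub> K"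
        using proj.hom_closed[OF coset_rep(1)[OF K'S, of C]] unfolding RCOSETS_def[of quotient] by blast
    next
      fix D assume "D \<in> rcosets\<^bsub>quotient\<^esub> K"
      then obtain x where x: "x \<in> carrier G" "D = K #>\<^bsub>quotient\<^esub> proj x"
        by (auto simp: RCOSETS_def carrier_quotient)
      have C: "K' #> x \<in> rcosets K'" using x(1) by (auto simp: RCOSETS_def)
      have "D = K #>\<^bsub>quotient\<^esub> proj (coset_rep (K' #> x))"
        using eq[OF coset_rep(1)[OF K'S C] x(1)] coset_rep(2)[OF K'S C] x(2) by simp
      then show "D \<in> (\<lambda>C. K #>\<^bsub>quotient\<^esub> proj (coset_rep C)) ` (rcosets K')" using C by blast
    qed
  qed
  note bij = this
  have idx: "card (rcosets K') = subgroup_index quotient K" "finite (rcosets K')"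
    using bij_betw_same_card[OF bij] bij_betw_finite[OF bij] K(2) by (simp_all add: subgroup_index_def)
  let ?H = "quotient\<lparr>carrier := K\<rparr>"
  have con: "generate ?H S = generate quotient S" if "S \<subseteq> K" for S
    using proj.H.generate_consistent[OF that K(1)] .
  \<comment> \<open>Schreier's lemma shows that \<open>K\<close> is finitely generated, so the
    \<open>LEAST\<close> in \<open>min_generators\<close> is attained.\<close>
  obtain Z where Z: "finite Z" "Z \<subseteq> K" "generate quotient Z = K"
    using proj.H.finite_index_imp_fin_gen[OF K _ generate_quotient] finite_gens by blast
  then have "\<exists>S. finite S \<and> card S = card Z \<and> generates ?H S"
    using con by (auto simp: generates_def)
  then have "\<exists>S. finite S \<and> card S = min_generators ?H \<and> generates ?H S"
    unfolding min_generators_def by (rule LeastI)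
  then obtain S where S: "finite S" "card S = min_generators ?H" "S \<subseteq> K" "generate quotient S = K"
    using con by (auto simp: generates_def)
  define Y where "Y = inv_into (carrier G) proj ` S"
  have SQ: "S \<subseteq> proj ` carrier G"
    using S(3) subgroup.subset[OF K(1)] by (simp add: carrier_quotient)
  have fY: "proj ` Y = S"
    unfolding Y_def using SQ by (force simp: image_image f_inv_into_f)
  have Yc: "Y \<subseteq> carrier G" unfolding Y_def using SQ inv_into_into[of _ proj "carrier G"] by auto
  have YK: "Y \<subseteq> K'" using Yc fY S(3) by (auto simp: K'_def)
  have "K' \<subseteq> generate G (residual \<union> Y)"
  proof
    fix x assume x: "x \<in> K'"
    have "proj x \<in> proj ` generate G Y"
      using x proj.generate_img[OF Yc] fY S(4) by (simp add: K'_def)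
    then obtain y where y: "y \<in> generate G Y" "proj x = proj y" by blast
    have c: "x \<in> carrier G" "y \<in> carrier G"
      using x generate_in_carrier[OF Yc y(1)] by (auto simp: K'_def)
    have "x \<otimes> inv y \<in> residual" using proj_eq_iff[OF c] y(2) by simp
    then have "x \<otimes> inv y \<otimes> y \<in> generate G (residual \<union> Y)"
      using mono_generate[of Y "residual \<union> Y"] y(1)
      by (blast intro: generate.eng generate.incl)
    then show "x \<in> generate G (residual \<union> Y)" using c by (simp add: m_assoc)
  qed
  then have "card (rcosets K') + 2 \<le> 2 * card Y"
    using min_generators_ge[OF A K'S idx(2) RK _ YK] S(1) by (simp add: Y_def)
  moreover have "card Y \<le> card S" unfolding Y_def by (rule card_image_le[OF S(1)])
  ultimately show ?thesis using idx(1) S(2) by linarith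
qed

text \<open>In a finite quotient the trivial subgroup would have finite index; being generated by
  the empty set, it violates \<open>min_generators_quotient\<close>.\<close>

lemma infinite_quotient: "infinite (carrier quotient)"
proof
  assume fin: "finite (carrier quotient)"
  let ?K = "{\<one>\<^bsub>quotient\<^esub>}"
  have S: "subgroup ?K quotient" by (rule proj.H.triv_subgroup)
  then have "finite_index_subgroup ?K quotient"
    using fin by (simp add: finite_index_subgroup_def RCOSETS_def)
  then have "2 \<le> 2 * min_generators (quotient\<lparr>carrier := ?K\<rparr>)"
    using min_generators_quotient by fastforce
  moreover have "generates (quotient\<lparr>carrier := ?K\<rparr>) {}"
    using group.generate_empty[OF subgroup.subgroup_is_group[OF S proj.H.is_group]]
    by (simp add: generates_def)
  then have "min_generators (quotient\<lparr>carrier := ?K\<rparr>) \<le> 0"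
    unfolding min_generators_def by (intro Least_le exI[of _ "{}"]) simp
  ultimately show False by simp
qed

lemma rank_gradient_quotient: "rank_gradient quotient \<ge> 1 / 2"
  unfolding rank_gradient_def
proof (rule cINF_greatest)
  have "rcosets\<^bsub>quotient\<^esub> carrier quotient = {carrier quotient}"
    using proj.H.coset_join2[OF _ proj.H.subgroup_self] proj.H.one_closed by (auto simp: RCOSETS_def)
  then have "finite_index_subgroup (carrier quotient) quotient"
    using proj.H.subgroup_self by (simp add: finite_index_subgroup_def)
  then show "{H. finite_index_subgroup H quotient} \<noteq> {}" by blast
next
  fix K assume "K \<in> {H. finite_index_subgroup H quotient}"
  then have K: "finite_index_subgroup K quotient" by simp
  let ?d = "min_generators (quotient\<lparr>carrier := K\<rparr>)"
  have "subgroup_index quotient K > 0"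
    using K subgroup.subgroup_in_rcosets[OF _ proj.H.is_group, of K]
    by (auto simp: finite_index_subgroup_def subgroup_index_def card_gt_0_iff)
  moreover have "real (subgroup_index quotient K + 2) \<le> real (2 * ?d)"
    using min_generators_quotient[OF K] by (rule of_nat_mono)
  ultimately show "1 / 2 \<le> (real ?d - 1) / real (subgroup_index quotient K)"
    by (simp add: field_simps)
qed

end

section \<open>Specialisation to the free group of rank two\<close>

lemma abundant_free_group2: "abundant_group free_group2 (range free_gen)"
proof -
  interpret group free_group2 by (rule group_free_group2)
  have c: "range free_gen \<subseteq> carrier free_group2" using free_gen_in by blast
  show ?thesis
  proof unfold_locales
    show "finite (range free_gen)" by simp
    show "range free_gen \<subseteq> carrier free_group2" by (rule c)
    show "generate free_group2 (range free_gen) = carrier free_group2" by (rule generate_free_gen)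
    fix H p assume H: "subgroup H free_group2" "finite (rcosets\<^bsub>free_group2\<^esub> H)" and "prime (p::nat)"
    then have p: "p > 0" by (simp add: prime_gt_0_nat)
    show "p ^ (card (rcosets\<^bsub>free_group2\<^esub> H) + 1) \<le> card (mod_homs free_group2 H p)"
      using card_mod_homs_free_group2[OF H p finite_mod_homs[OF H p _ c generate_free_gen]] by simp
  qed
qed

text \<open>If \<open>p\<close> has finitely many values on the positive integers, one of them
  occurs infinitely often; otherwise the first occurrences of the values form an infinite set on
  which \<open>p\<close> is injective.\<close>

lemma infinite_const_or_inj_subset:
  fixes p :: "nat \<Rightarrow> nat"
  obtains A where "infinite A" "A \<subseteq> {1..}" "inj_on p A \<or> (\<exists>q. \<forall>i\<in>A. p i = q)"
proof (cases "finite (p ` {1..})")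
  case True
  then obtain k where "infinite {i \<in> {1..}. p i = p k}"
    using pigeonhole_infinite[OF infinite_Ici True] by auto
  then show thesis using that[of "{i \<in> {1..}. p i = p k}"] by auto
next
  case False
  define A where "A = {i \<in> {1..}. \<forall>k\<ge>1. k < i \<longrightarrow> p k \<noteq> p i}"
  have "p i \<in> p ` A" if "i \<ge> 1" for i
  proof -
    let ?k = "LEAST k. k \<ge> 1 \<and> p k = p i"
    have k: "?k \<ge> 1 \<and> p ?k = p i" using LeastI[of "\<lambda>k. k \<ge> 1 \<and> p k = p i" i] that by simp
    have "p j \<noteq> p ?k" if j: "j \<ge> 1" "j < ?k" for j
      using not_less_Least[OF j(2)] j(1) k by simp
    then have "?k \<in> A" unfolding A_def using k by simp
    then show ?thesis by (rule image_eqI[rotated]) (rule k[THEN conjunct2, symmetric])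
  qed
  then have "p ` {1..} \<subseteq> p ` A" by auto
  then have "infinite A" using False finite_subset by blast
  moreover have "inj_on p A"
    by (rule linorder_inj_onI) (auto simp: A_def)
  ultimately show thesis using that[of A] by (auto simp: A_def)
qed

theorem theorem1p1:
  fixes p :: "nat \<Rightarrow> nat"
  assumes "\<And>i. i \<ge> 1 \<Longrightarrow> prime (p i)"
  shows "\<exists>Q :: nat monoid.
    group Q \<and> finitely_generated Q \<and> infinite (carrier Q) \<and> torsion_group Q \<and>
    graded_group p Q \<and> rank_gradient Q > 0"
proof -
  obtain A where A: "infinite A" "A \<subseteq> {1..}" "inj_on p A \<or> (\<exists>q. \<forall>i\<in>A. p i = q)"
    using infinite_const_or_inj_subset[of p] .
  interpret F: abundant_group free_group2 "range free_gen" by (rule abundant_free_group2)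
  have "countable (carrier free_group2)"
    using F.countable_generate[OF countable_finite[OF F.finite_gens] F.gens_closed] F.gens by simp
  then interpret R: residual_quotient free_group2 "range free_gen"
      "from_nat_into (carrier free_group2)" p A
  proof unfold_locales
    show "range (from_nat_into (carrier free_group2)) = carrier free_group2"
      using range_from_nat_into[OF F.carrier_not_empty] \<open>countable (carrier free_group2)\<close> .
    show "prime (p i)" if "i \<in> A" for i using assms[of i] A(2) that by auto
    show "infinite A" "inj_on p A \<or> (\<exists>q. \<forall>i\<in>A. p i = q)" by (rule A)+
  qed
  have "finitely_generated R.quotient"
    unfolding finitely_generated_def generates_def
    using R.generate_quotient F.gens_closed
    by (intro exI[of _ "R.proj ` range free_gen"]) (auto simp: R.carrier_quotient)
  then show ?thesis
    using R.proj.H.is_group R.infinite_quotient R.torsion_quotient R.graded_quotient[OF assms]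
      R.rank_gradient_quotient by (intro exI[of _ R.quotient]) auto
qed

end
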